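(* Let $\boldsymbol{\delta}=(1,2,1,2,1,2,3)$ and consider the vectors in $\mathbb{Z}^7$ $v_1=(0,0,0,0,0,0,1)$, $v_2=(0,1,0,1,0,1,1)$, $v_3=(1,1,1,1,1,1,2)$, $v_4=(1,2,1,2,1,2,2)$. For $k\ge1$ put $d_k=v_r+q\boldsymbol{\delta}$, where $k=4q+r$ with $q\ge 0$ and $1\le r\le 4$. Let $$D_3=\begin{pmatrix} -1&1&0&0&0&0&0\\ -1&1&0&1&0&1&-1\\ 0&0&-1&1&0&0&0\\ 0&1&-1&1&0&1&-1\\ 0&0&0&0&-1&1&0\\ 0&1&0&1&-1&1&-1\\ -1&2&-1&2&-1&2&-2\end{pmatrix}$$ and for $k\ge 4$ define $$D_k=\begin{cases} D_3\, c^{\,s-2} M_f, & k=2s,\\ D_3\, c^{\,s-2}\,\overset{\circ}{c}\, M_f, & k=2s+1.\end{cases}$$ Let $\chi=(\alpha_1,\alpha_2,\beta_1,\beta_2,\delta_1,\delta_2,\gamma)$ be a real vector with $\alpha_1>\alpha_2>0$, $\beta_1>\beta_2>0$, $\delta_1>\delta_2>0$. Then for every $k\ge 5$ the $*$-algebra $\mathcal{A}_{\widetilde{E}_6,\chi}$ has an irreducible non-degenerate $*$-representation of generalized dimension $M_d d_k$ if and only if the first six coordinates of the vector $D_k\chi$ are strictly positive and its seventh coordinate equals $0$.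
   Context: The $*$-algebra $\mathcal{A}_{\widetilde{E}_6,\chi}$ is the unital complex $*$-algebra generated by self-adjoint idempotents $p_1,p_2,q_1,q_2,s_1,s_2$ with relations $p_1p_2=p_2p_1=0$, $q_1q_2=q_2q_1=0$, $s_1s_2=s_2s_1=0$ and $$\alpha_1p_1+\alpha_2p_2+\beta_1q_1+\beta_2q_2+\delta_1s_1+\delta_2s_2=\gamma e,$$ where $e$ is the identity. Equivalently, its $*$-representations are triples of Hermitian operators $A,B,D$ on a Hilbert space with spectra contained in $\{0,\alpha_1,\alpha_2\}$, $\{0,\beta_1,\beta_2\}$, $\{0,\delta_1,\delta_2\}$ and $A+B+D=\gamma I$. An irreducible finite-dimensional $*$-representation $\pi$ on a Hilbert space $H_0$ is called non-degenerate if $\pi(p_i),\pi(q_i),\pi(s_i)\ne 0$ for $i=1,2$ and $\pi(p_1)+\pi(p_2)\neq I$, $\pi(q_1)+\pi(q_2)\ne I$, $\pi(s_1)+\pi(s_2)\ne I$. Its generalized dimension is the vector $(\operatorname{rank}\pi(p_1),\operatorname{rank}\pi(p_2),\operatorname{rank}\pi(q_1),\operatorname{rank}\pi(q_2),\operatorname{rank}\pi(s_1),\operatorname{rank}\pi(s_2),\dim H_0)$. The graph $\widetilde{E}_6$ has central vertex $g_0$ and three branches $g_0-g_2-g_1$, $g_0-g_4-g_3$, $g_0-g_6-g_5$. Vectors indexed by its vertices are written $(x_1,x_2,x_3,x_4,x_5,x_6,x_0)$. The vertices $g_1,g_3,g_5,g_0$ are odd, and $g_2,g_4,g_6$ are even.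 The linear maps $\overset{\bullet}{c},\overset{\circ}{c}$ of $\mathbb{R}^7$ (both involutions) are $$\overset{\bullet}{c}(x)=(-x_1+x_2,\,x_2,\,-x_3+x_4,\,x_4,\,-x_5+x_6,\,x_6,\,-x_0+x_2+x_4+x_6),$$ $$\overset{\circ}{c}(x)=(x_1,\,-x_2+x_1+x_0,\,x_3,\,-x_4+x_3+x_0,\,x_5,\,-x_6+x_5+x_0,\,x_0),$$ and $c=\overset{\circ}{c}\,\overset{\bullet}{c}$ (first $\overset{\bullet}{c}$, then $\overset{\circ}{c}$), so $c^{-1}=\overset{\bullet}{c}\,\overset{\circ}{c}$. All matrices and maps act on column vectors. The transition matrices are given by $M_f\chi=(\alpha_1-\alpha_2,\,\alpha_1,\,\beta_1-\beta_2,\,\beta_1,\,\delta_1-\delta_2,\,\delta_1,\,\gamma)$ and $M_d(x_1,\dots,x_6,x_0)=(x_2-x_1,\,x_1,\,x_4-x_3,\,x_3,\,x_6-x_5,\,x_5,\,x_0)$. *)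

theory Defs
  imports
    "Jordan_Normal_Form.Schur_Decomposition"
    "Jordan_Normal_Form.DL_Rank"
    "HOL-Algebra.RingHom"
begin

record 'a star_alg = "(complex, 'a) module" +
  star :: "'a \<Rightarrow> 'a"

locale star_algebra = ring A + Module.module "class_ring :: complex ring" A
  for A :: "('a, 'm) star_alg_scheme" (structure) +
  assumes smult_mult_left: "\<lbrakk>x \<in> carrier A; y \<in> carrier A\<rbrakk>
      \<Longrightarrow> (c \<odot>\<^bsub>A\<^esub> x) \<otimes>\<^bsub>A\<^esub> y = c \<odot>\<^bsub>A\<^esub> (x \<otimes>\<^bsub>A\<^esub> y)"
    and smult_mult_right: "\<lbrakk>x \<in> carrier A; y \<in> carrier A\<rbrakk>
      \<Longrightarrow> x \<otimes>\<^bsub>A\<^esub> (c \<odot>\<^bsub>A\<^esub> y) = c \<odot>\<^bsub>A\<^esub> (x \<otimes>\<^bsub>A\<^esub> y)"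
    and star_closed: "x \<in> carrier A \<Longrightarrow> star A x \<in> carrier A"
    and star_star: "x \<in> carrier A \<Longrightarrow> star A (star A x) = x"
    and star_add: "\<lbrakk>x \<in> carrier A; y \<in> carrier A\<rbrakk>
      \<Longrightarrow> star A (x \<oplus>\<^bsub>A\<^esub> y) = star A x \<oplus>\<^bsub>A\<^esub> star A y"
    and star_mult: "\<lbrakk>x \<in> carrier A; y \<in> carrier A\<rbrakk>
      \<Longrightarrow> star A (x \<otimes>\<^bsub>A\<^esub> y) = star A y \<otimes>\<^bsub>A\<^esub> star A x"
    and star_smult: "x \<in> carrier A \<Longrightarrow> star A (c \<odot>\<^bsub>A\<^esub> x) = cnj c \<odot>\<^bsub>A\<^esub> star A x"

definition star_hom :: "('a, 'm) star_alg_scheme \<Rightarrow> ('b, 'n) star_alg_scheme \<Rightarrow> ('a \<Rightarrow> 'b) set" where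
  "star_hom A B = {h \<in> Ring.ring_hom A B.
     (\<forall>c. \<forall>x \<in> carrier A. h (c \<odot>\<^bsub>A\<^esub> x) = c \<odot>\<^bsub>B\<^esub> h x) \<and>
     (\<forall>x \<in> carrier A. h (star A x) = star B (h x))}"

text \<open>The algebra of all operators on the Hilbert space \<open>\<complex>\<^sup>n\<close> with its standard inner product.\<close>

definition matrix_star_alg :: "nat \<Rightarrow> complex mat star_alg" where
  "matrix_star_alg n = \<lparr>carrier = carrier_mat n n, monoid.mult = (*), one = 1\<^sub>m n,
     zero = 0\<^sub>m n n, add = (+), module.smult = (\<cdot>\<^sub>m), star = mat_adjoint\<rparr>"

lemma mat_adjoint_index:
  assumes "A \<in> carrier_mat n n" "i < n" "j < n"
  shows "mat_adjoint A $$ (i, j) = conjugate (A $$ (j, i))"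
  using assms by (auto simp: mat_adjoint_def mat_of_rows_def)

lemma mat_adjoint_closed: "A \<in> carrier_mat n n \<Longrightarrow> mat_adjoint A \<in> carrier_mat n n"
  by (auto simp: mat_adjoint_def mat_of_rows_def)

lemma star_algebra_matrix: "star_algebra (matrix_star_alg n)"
proof -
  let ?A = "matrix_star_alg n"
  have [simp]: "carrier ?A = carrier_mat n n" "monoid.mult ?A = (*)" "monoid.one ?A = 1\<^sub>m n"
    "ring.zero ?A = 0\<^sub>m n n" "ring.add ?A = (+)" "module.smult ?A = (\<cdot>\<^sub>m)"
    "star ?A = mat_adjoint"
    by (simp_all add: matrix_star_alg_def)
  have ring: "ring ?A"
  proof (rule ringI)
    show "abelian_group ?A"
    proof (rule abelian_groupI)
      fix x assume "x \<in> carrier ?A"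
      then show "\<exists>y\<in>carrier ?A. y \<oplus>\<^bsub>?A\<^esub> x = \<zero>\<^bsub>?A\<^esub>"
        by (intro bexI[of _ "- x"]) auto
    qed (auto intro: comm_add_mat assoc_add_mat)
    show "Group.monoid ?A"
      by (rule monoidI) (auto intro: assoc_mult_mat)
  qed (auto intro: add_mult_distrib_mat mult_add_distrib_mat)
  have cring: "cring (class_ring :: complex ring)"
    using class_field[where 'a = complex] unfolding field_def domain_def by blast
  have module: "Module.module (class_ring :: complex ring) ?A"
    by (rule Module.moduleI)
       (auto simp: ring.is_abelian_group[OF ring] cring algebra_simps intro!: eq_matI)
  have adj_mult: "mat_adjoint (A * B) = mat_adjoint B * mat_adjoint A"
    if "A \<in> carrier_mat n n" "B \<in> carrier_mat n n" for A B :: "complex mat"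
  proof (rule eq_matI)
    have c: "A * B \<in> carrier_mat n n" using that by simp
    have d: "mat_adjoint A \<in> carrier_mat n n" "mat_adjoint B \<in> carrier_mat n n"
      "mat_adjoint (A * B) \<in> carrier_mat n n"
      using that c mat_adjoint_closed by blast+
    show "dim_row (mat_adjoint (A * B)) = dim_row (mat_adjoint B * mat_adjoint A)"
      "dim_col (mat_adjoint (A * B)) = dim_col (mat_adjoint B * mat_adjoint A)"
      using d by simp_all
    fix i j assume "i < dim_row (mat_adjoint B * mat_adjoint A)"
      "j < dim_col (mat_adjoint B * mat_adjoint A)"
    then have ij: "i < n" "j < n" using d by auto
    have "mat_adjoint (A * B) $$ (i, j) = (\<Sum>k<n. cnj (A $$ (j, k)) * cnj (B $$ (k, i)))"
      using that ij by (simp add: mat_adjoint_index[OF c] scalar_prod_def atLeast0LessThan)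
    also have "\<dots> = (\<Sum>k<n. mat_adjoint B $$ (i, k) * mat_adjoint A $$ (k, j))"
      using that ij by (intro sum.cong) (auto simp: mat_adjoint_index)
    also have "\<dots> = (mat_adjoint B * mat_adjoint A) $$ (i, j)"
      using d ij by (simp add: scalar_prod_def atLeast0LessThan)
    finally show "mat_adjoint (A * B) $$ (i, j) = (mat_adjoint B * mat_adjoint A) $$ (i, j)" .
  qed
  have adj_adj: "mat_adjoint (mat_adjoint A) = A"
    if "A \<in> carrier_mat n n" for A :: "complex mat"
    using mat_adjoint_closed[OF that] mat_adjoint_closed[OF mat_adjoint_closed[OF that]] that
    by (intro eq_matI) (auto simp: mat_adjoint_index)
  have adj_add: "mat_adjoint (A + B) = mat_adjoint A + mat_adjoint B"
    if "A \<in> carrier_mat n n" "B \<in> carrier_mat n n" for A B :: "complex mat"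
    using mat_adjoint_closed[OF that(1)] mat_adjoint_closed[OF that(2)]
      mat_adjoint_closed[of "A + B" n] that
    by (intro eq_matI) (auto simp: mat_adjoint_index[where n = n])
  have adj_smult: "mat_adjoint (c \<cdot>\<^sub>m A) = cnj c \<cdot>\<^sub>m mat_adjoint A"
    if "A \<in> carrier_mat n n" for c and A :: "complex mat"
    using mat_adjoint_closed[OF that] mat_adjoint_closed[of "c \<cdot>\<^sub>m A" n] that
    by (intro eq_matI) (auto simp: mat_adjoint_index[where n = n])
  show ?thesis
    by (intro star_algebra.intro star_algebra_axioms.intro ring module)
       (auto simp: adj_mult adj_adj adj_add adj_smult mat_adjoint_closed)
qed

datatype 'g star_expr =
    Gen 'g
  | Zero
  | One
  | Add "'g star_expr" "'g star_expr"
  | Mult "'g star_expr" "'g star_expr"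
  | Scale complex "'g star_expr"
  | Star "'g star_expr"

text \<open>The least congruence on *-expressions that contains the relations \<open>R\<close> and makes the
  quotient a unital complex *-algebra. A pair \<open>(x, y) \<in> R\<close> stands for the relation \<open>x = y\<close>.\<close>

inductive star_cong :: "('g star_expr \<times> 'g star_expr) set \<Rightarrow> 'g star_expr \<Rightarrow> 'g star_expr \<Rightarrow> bool"
  for R where
  rel: "(x, y) \<in> R \<Longrightarrow> star_cong R x y"
| refl: "star_cong R x x"
| sym: "star_cong R x y \<Longrightarrow> star_cong R y x"
| trans: "star_cong R x y \<Longrightarrow> star_cong R y z \<Longrightarrow> star_cong R x z"
| add_cong: "star_cong R x x' \<Longrightarrow> star_cong R y y' \<Longrightarrow> star_cong R (Add x y) (Add x' y')"
| mult_cong: "star_cong R x x' \<Longrightarrow> star_cong R y y' \<Longrightarrow> star_cong R (Mult x y) (Mult x' y')"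
| scale_cong: "star_cong R x x' \<Longrightarrow> star_cong R (Scale c x) (Scale c x')"
| star_cong: "star_cong R x x' \<Longrightarrow> star_cong R (Star x) (Star x')"
| add_assoc: "star_cong R (Add (Add x y) z) (Add x (Add y z))"
| add_comm: "star_cong R (Add x y) (Add y x)"
| add_zero: "star_cong R (Add Zero x) x"
| add_inverse: "star_cong R (Add (Scale (- 1) x) x) Zero"
| mult_assoc: "star_cong R (Mult (Mult x y) z) (Mult x (Mult y z))"
| one_mult: "star_cong R (Mult One x) x"
| mult_one: "star_cong R (Mult x One) x"
| distrib_right: "star_cong R (Mult (Add x y) z) (Add (Mult x z) (Mult y z))"
| distrib_left: "star_cong R (Mult z (Add x y)) (Add (Mult z x) (Mult z y))"
| scale_add: "star_cong R (Scale c (Add x y)) (Add (Scale c x) (Scale c y))"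
| add_scale: "star_cong R (Scale (c + d) x) (Add (Scale c x) (Scale d x))"
| scale_scale: "star_cong R (Scale (c * d) x) (Scale c (Scale d x))"
| scale_one: "star_cong R (Scale 1 x) x"
| scale_mult: "star_cong R (Mult (Scale c x) y) (Scale c (Mult x y))"
| mult_scale: "star_cong R (Mult x (Scale c y)) (Scale c (Mult x y))"
| star_star: "star_cong R (Star (Star x)) x"
| star_add: "star_cong R (Star (Add x y)) (Add (Star x) (Star y))"
| star_mult: "star_cong R (Star (Mult x y)) (Mult (Star y) (Star x))"
| star_scale: "star_cong R (Star (Scale c x)) (Scale (cnj c) (Star x))"

definition star_rel :: "('g star_expr \<times> 'g star_expr) set \<Rightarrow> ('g star_expr \<times> 'g star_expr) set" where
  "star_rel R = {(x, y). star_cong R x y}"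

definition star_class :: "('g star_expr \<times> 'g star_expr) set \<Rightarrow> 'g star_expr \<Rightarrow> 'g star_expr set" where
  "star_class R x = star_rel R `` {x}"

definition presented_star_alg ::
    "('g star_expr \<times> 'g star_expr) set \<Rightarrow> 'g star_expr set star_alg" where
  "presented_star_alg R = \<lparr>
     carrier = UNIV // star_rel R,
     monoid.mult = (\<lambda>X Y. \<Union>x\<in>X. \<Union>y\<in>Y. star_class R (Mult x y)),
     one = star_class R One,
     zero = star_class R Zero,
     add = (\<lambda>X Y. \<Union>x\<in>X. \<Union>y\<in>Y. star_class R (Add x y)),
     module.smult = (\<lambda>c X. \<Union>x\<in>X. star_class R (Scale c x)),
     star = (\<lambda>X. \<Union>x\<in>X. star_class R (Star x))\<rparr>"

lemma equiv_star_rel: "equiv UNIV (star_rel R)"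
  by (rule equivI)
     (auto simp: star_rel_def refl_on_def sym_def trans_def intro: star_cong.intros)

lemma star_class_eq_iff: "star_class R x = star_class R y \<longleftrightarrow> star_cong R x y"
  unfolding star_class_def using eq_equiv_class_iff[OF equiv_star_rel, of x y R]
  by (simp add: star_rel_def)

lemma star_class_mem: "y \<in> star_class R x \<longleftrightarrow> star_cong R x y"
  by (simp add: star_class_def star_rel_def)

lemma star_class_in_carrier: "star_class R x \<in> carrier (presented_star_alg R)"
  by (simp add: presented_star_alg_def star_class_def quotientI)

lemma presented_carrierE:
  assumes "X \<in> carrier (presented_star_alg R)"
  obtains x where "X = star_class R x"
  using assms by (auto simp: presented_star_alg_def star_class_def elim: quotientE)

lemma UN_star_class:
  assumes "\<And>y. star_cong R x y \<Longrightarrow> f y = f x"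
  shows "(\<Union>y\<in>star_class R x. f y) = f x"
proof -
  have "(\<Union>y\<in>star_class R x. f y) = (\<Union>y\<in>star_class R x. f x)"
    by (rule SUP_cong) (simp_all add: star_class_mem assms)
  moreover have "x \<in> star_class R x" by (simp add: star_class_mem star_cong.refl)
  ultimately show ?thesis by auto
qed

lemma presented_ops:
  "star_class R x \<otimes>\<^bsub>presented_star_alg R\<^esub> star_class R y = star_class R (Mult x y)"
  "star_class R x \<oplus>\<^bsub>presented_star_alg R\<^esub> star_class R y = star_class R (Add x y)"
  "c \<odot>\<^bsub>presented_star_alg R\<^esub> star_class R x = star_class R (Scale c x)"
  "star (presented_star_alg R) (star_class R x) = star_class R (Star x)"
  "\<one>\<^bsub>presented_star_alg R\<^esub> = star_class R One"
  "\<zero>\<^bsub>presented_star_alg R\<^esub> = star_class R Zero"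
proof -
  have *: "(\<Union>x'\<in>star_class R x. \<Union>y'\<in>star_class R y. star_class R (f x' y')) = star_class R (f x y)"
    if "\<And>x' y'. star_cong R x x' \<Longrightarrow> star_cong R y y' \<Longrightarrow> star_cong R (f x' y') (f x y)" for f
  proof -
    have eq: "star_class R (f x' y') = star_class R (f x y)"
      if "star_cong R x x'" "star_cong R y y'" for x' y'
      using \<open>\<And>x' y'. star_cong R x x' \<Longrightarrow> star_cong R y y' \<Longrightarrow> star_cong R (f x' y') (f x y)\<close> that
      by (simp only: star_class_eq_iff)
    have inner: "(\<Union>y'\<in>star_class R y. star_class R (f x' y')) = star_class R (f x y)"
      if "star_cong R x x'" for x'
      using UN_star_class[of R y "\<lambda>y'. star_class R (f x' y')"] eq[OF that] star_cong.refl[of R y]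
      by metis
    show ?thesis
      using UN_star_class[of R x "\<lambda>x'. \<Union>y'\<in>star_class R y. star_class R (f x' y')"]
        inner star_cong.refl[of R x] by metis
  qed
  show "star_class R x \<otimes>\<^bsub>presented_star_alg R\<^esub> star_class R y = star_class R (Mult x y)"
    "star_class R x \<oplus>\<^bsub>presented_star_alg R\<^esub> star_class R y = star_class R (Add x y)"
    by (simp_all add: presented_star_alg_def)
       (rule *, blast intro: star_cong.sym star_cong.mult_cong star_cong.add_cong)+
  show "c \<odot>\<^bsub>presented_star_alg R\<^esub> star_class R x = star_class R (Scale c x)"
    "star (presented_star_alg R) (star_class R x) = star_class R (Star x)"
    by (simp_all add: presented_star_alg_def)
       (rule UN_star_class, simp add: star_class_eq_iff,
        blast intro: star_cong.sym star_cong.scale_cong star_cong.star_cong)+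
qed (simp_all add: presented_star_alg_def)

lemma star_algebra_presented: "star_algebra (presented_star_alg R)"
proof -
  let ?A = "presented_star_alg R"
  have ring: "ring ?A"
  proof (rule ringI)
    show "abelian_group ?A"
    proof (rule abelian_groupI)
      fix X assume "X \<in> carrier ?A"
      then obtain x where "X = star_class R x" by (rule presented_carrierE)
      then show "\<exists>Y\<in>carrier ?A. Y \<oplus>\<^bsub>?A\<^esub> X = \<zero>\<^bsub>?A\<^esub>"
        by (intro bexI[of _ "star_class R (Scale (- 1) x)"])
           (simp_all add: presented_ops star_class_in_carrier star_class_eq_iff star_cong.add_inverse)
    qed ((elim presented_carrierE)?, simp add: presented_ops star_class_in_carrier
        star_class_eq_iff star_cong.add_assoc star_cong.add_comm star_cong.add_zero)+
    show "Group.monoid ?A"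
      by (rule monoidI)
         ((elim presented_carrierE)?, simp add: presented_ops star_class_in_carrier
           star_class_eq_iff star_cong.mult_assoc star_cong.one_mult star_cong.mult_one)+
  qed (elim presented_carrierE, simp add: presented_ops star_class_eq_iff
      star_cong.distrib_left star_cong.distrib_right)+
  have cring: "cring (class_ring :: complex ring)"
    using class_field[where 'a = complex] unfolding field_def domain_def by blast
  have module: "Module.module (class_ring :: complex ring) ?A"
    by (rule Module.moduleI)
       ((elim presented_carrierE)?, simp add: cring ring.is_abelian_group[OF ring] presented_ops
         star_class_in_carrier star_class_eq_iff star_cong.scale_add star_cong.add_scale
         star_cong.scale_scale star_cong.scale_one)+
  show ?thesis
    by (intro star_algebra.intro star_algebra_axioms.intro ring module)
       (elim presented_carrierE, simp add: presented_ops star_class_in_carrier star_class_eq_iff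
         star_cong.scale_mult star_cong.mult_scale star_cong.star_star star_cong.star_add
         star_cong.star_mult star_cong.star_scale)+
qed

text \<open>The universal property of the presented algebra: a family of elements satisfying the
  relations extends to a *-homomorphism.\<close>

primrec star_eval :: "('a, 'm) star_alg_scheme \<Rightarrow> ('g \<Rightarrow> 'a) \<Rightarrow> 'g star_expr \<Rightarrow> 'a" where
  "star_eval A f (Gen g) = f g"
| "star_eval A f Zero = \<zero>\<^bsub>A\<^esub>"
| "star_eval A f One = \<one>\<^bsub>A\<^esub>"
| "star_eval A f (Add x y) = star_eval A f x \<oplus>\<^bsub>A\<^esub> star_eval A f y"
| "star_eval A f (Mult x y) = star_eval A f x \<otimes>\<^bsub>A\<^esub> star_eval A f y"
| "star_eval A f (Scale c x) = c \<odot>\<^bsub>A\<^esub> star_eval A f x"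
| "star_eval A f (Star x) = star A (star_eval A f x)"

lemma presented_universal:
  assumes "star_algebra A" "\<And>g. f g \<in> carrier A"
    and rels: "\<And>x y. (x, y) \<in> R \<Longrightarrow> star_eval A f x = star_eval A f y"
  shows "\<exists>h \<in> star_hom (presented_star_alg R) A. \<forall>x. h (star_class R x) = star_eval A f x"
proof -
  interpret star_algebra A by fact
  have scale_closed: "c \<odot>\<^bsub>A\<^esub> x \<in> carrier A" if "x \<in> carrier A" for c x
    using that by (intro smult_closed) auto
  have closed: "star_eval A f x \<in> carrier A" for x
    by (induction x) (auto simp: assms(2) scale_closed star_closed)
  have smult_laws:
    "(c + d) \<odot>\<^bsub>A\<^esub> x = c \<odot>\<^bsub>A\<^esub> x \<oplus>\<^bsub>A\<^esub> d \<odot>\<^bsub>A\<^esub> x"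
    "(c * d) \<odot>\<^bsub>A\<^esub> x = c \<odot>\<^bsub>A\<^esub> (d \<odot>\<^bsub>A\<^esub> x)"
    "1 \<odot>\<^bsub>A\<^esub> x = x"
    if "x \<in> carrier A" for c d x
    using smult_l_distr[of c d x] smult_assoc1[of c d x] smult_one[of x] that by simp_all
  have smult_r: "c \<odot>\<^bsub>A\<^esub> (x \<oplus>\<^bsub>A\<^esub> y) = c \<odot>\<^bsub>A\<^esub> x \<oplus>\<^bsub>A\<^esub> c \<odot>\<^bsub>A\<^esub> y"
    if "x \<in> carrier A" "y \<in> carrier A" for c x y
    using smult_r_distr[of c x y] that by simp
  have inv: "(- 1) \<odot>\<^bsub>A\<^esub> x \<oplus>\<^bsub>A\<^esub> x = \<zero>\<^bsub>A\<^esub>" if "x \<in> carrier A" for x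
  proof -
    have "0 \<odot>\<^bsub>A\<^esub> x = \<zero>\<^bsub>A\<^esub>" using smult_l_null[OF that] by simp
    then show ?thesis using smult_laws(1)[OF that, of "- 1" 1] smult_laws(3)[OF that] by simp
  qed
  have sound: "star_eval A f x = star_eval A f y" if "star_cong R x y" for x y
    using that
  proof (induction rule: star_cong.induct)
    case (rel x y)
    then show ?case by (rule rels)
  next
    case (add_comm x y)
    then show ?case by (simp add: a_comm closed)
  qed (simp_all add: closed a_assoc m_assoc l_distr r_distr smult_laws smult_r inv
        smult_mult_left smult_mult_right star_star star_add star_mult star_smult
        star_closed scale_closed)
  define h where "h X = star_eval A f (SOME x. x \<in> X)" for X
  have h: "h (star_class R x) = star_eval A f x" for x
  proof -
    have "(SOME y. y \<in> star_class R x) \<in> star_class R x"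
      by (rule someI[of _ x]) (simp add: star_class_mem star_cong.refl)
    then have "star_cong R x (SOME y. y \<in> star_class R x)" by (simp only: star_class_mem)
    from sound[OF this] show ?thesis by (simp only: h_def)
  qed
  have "h \<in> star_hom (presented_star_alg R) A"
    unfolding star_hom_def Ring.ring_hom_def mem_Collect_eq
    by (intro conjI allI ballI impI funcsetI; (elim conjE presented_carrierE)?;
        simp only: presented_ops h closed star_eval.simps)
  with h show ?thesis by blast
qed

datatype e6_gen = P1 | P2 | Q1 | Q2 | S1 | S2

text \<open>The argument \<open>\<chi>\<close> lists \<open>(\<alpha>\<^sub>1, \<alpha>\<^sub>2, \<beta>\<^sub>1, \<beta>\<^sub>2, \<delta>\<^sub>1, \<delta>\<^sub>2, \<gamma>)\<close> at positions 0 to 6.\<close>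

definition e6_relations :: "real vec \<Rightarrow> (e6_gen star_expr \<times> e6_gen star_expr) set" where
  "e6_relations \<chi> =
     (\<Union>g. {(Star (Gen g), Gen g), (Mult (Gen g) (Gen g), Gen g)}) \<union>
     {(Mult (Gen P1) (Gen P2), Zero), (Mult (Gen P2) (Gen P1), Zero),
      (Mult (Gen Q1) (Gen Q2), Zero), (Mult (Gen Q2) (Gen Q1), Zero),
      (Mult (Gen S1) (Gen S2), Zero), (Mult (Gen S2) (Gen S1), Zero),
      (Add (Scale (complex_of_real (\<chi> $ 0)) (Gen P1))
        (Add (Scale (complex_of_real (\<chi> $ 1)) (Gen P2))
        (Add (Scale (complex_of_real (\<chi> $ 2)) (Gen Q1))
        (Add (Scale (complex_of_real (\<chi> $ 3)) (Gen Q2))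
        (Add (Scale (complex_of_real (\<chi> $ 4)) (Gen S1))
             (Scale (complex_of_real (\<chi> $ 5)) (Gen S2)))))),
       Scale (complex_of_real (\<chi> $ 6)) One)}"

definition e6_alg :: "real vec \<Rightarrow> e6_gen star_expr set star_alg" where
  "e6_alg \<chi> = presented_star_alg (e6_relations \<chi>)"

definition e6_gen_elem :: "real vec \<Rightarrow> e6_gen \<Rightarrow> e6_gen star_expr set" where
  "e6_gen_elem \<chi> g = star_class (e6_relations \<chi>) (Gen g)"

text \<open>Every finite-dimensional Hilbert space is unitarily equivalent to some \<open>\<complex>\<^sup>n\<close>, so
  finite-dimensional *-representations are taken on \<open>\<complex>\<^sup>n\<close>.\<close>

definition star_rep :: "real vec \<Rightarrow> nat \<Rightarrow> (e6_gen star_expr set \<Rightarrow> complex mat) \<Rightarrow> bool" where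
  "star_rep \<chi> n \<pi> \<longleftrightarrow> \<pi> \<in> star_hom (e6_alg \<chi>) (matrix_star_alg n)"

definition irreducible_rep :: "real vec \<Rightarrow> nat \<Rightarrow> (e6_gen star_expr set \<Rightarrow> complex mat) \<Rightarrow> bool" where
  "irreducible_rep \<chi> n \<pi> \<longleftrightarrow> n > 0 \<and>
     (\<forall>W. VectorSpace.subspace class_ring W (module_vec TYPE(complex) n) \<and>
          (\<forall>a \<in> carrier (e6_alg \<chi>). \<forall>w \<in> W. \<pi> a *\<^sub>v w \<in> W)
        \<longrightarrow> W = {0\<^sub>v n} \<or> W = carrier_vec n)"

definition nondegenerate_rep :: "real vec \<Rightarrow> nat \<Rightarrow> (e6_gen star_expr set \<Rightarrow> complex mat) \<Rightarrow> bool" where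
  "nondegenerate_rep \<chi> n \<pi> \<longleftrightarrow>
     (\<forall>g. \<pi> (e6_gen_elem \<chi> g) \<noteq> 0\<^sub>m n n) \<and>
     \<pi> (e6_gen_elem \<chi> P1) + \<pi> (e6_gen_elem \<chi> P2) \<noteq> 1\<^sub>m n \<and>
     \<pi> (e6_gen_elem \<chi> Q1) + \<pi> (e6_gen_elem \<chi> Q2) \<noteq> 1\<^sub>m n \<and>
     \<pi> (e6_gen_elem \<chi> S1) + \<pi> (e6_gen_elem \<chi> S2) \<noteq> 1\<^sub>m n"

definition generalized_dim :: "real vec \<Rightarrow> nat \<Rightarrow> (e6_gen star_expr set \<Rightarrow> complex mat) \<Rightarrow> int vec" where
  "generalized_dim \<chi> n \<pi> = vec_of_list
     (map (\<lambda>g. int (vec_space.rank n (\<pi> (e6_gen_elem \<chi> g)))) [P1, P2, Q1, Q2, S1, S2] @ [int n])"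

text \<open>A vector \<open>(x\<^sub>1, x\<^sub>2, x\<^sub>3, x\<^sub>4, x\<^sub>5, x\<^sub>6, x\<^sub>0)\<close> indexed by the vertices is stored with
  zero-based positions in this order: the coordinate of the central vertex is at position 6.\<close>

definition c_bullet :: "real vec \<Rightarrow> real vec" where
  "c_bullet x = vec_of_list
     [- x $ 0 + x $ 1, x $ 1, - x $ 2 + x $ 3, x $ 3, - x $ 4 + x $ 5, x $ 5,
      - x $ 6 + x $ 1 + x $ 3 + x $ 5]"

definition c_circ :: "real vec \<Rightarrow> real vec" where
  "c_circ x = vec_of_list
     [x $ 0, - x $ 1 + x $ 0 + x $ 6, x $ 2, - x $ 3 + x $ 2 + x $ 6,
      x $ 4, - x $ 5 + x $ 4 + x $ 6, x $ 6]"

definition coxeter :: "real vec \<Rightarrow> real vec" where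
  "coxeter = c_circ \<circ> c_bullet"

definition M_f :: "real vec \<Rightarrow> real vec" where
  "M_f \<chi> = vec_of_list
     [\<chi> $ 0 - \<chi> $ 1, \<chi> $ 0, \<chi> $ 2 - \<chi> $ 3, \<chi> $ 2, \<chi> $ 4 - \<chi> $ 5, \<chi> $ 4, \<chi> $ 6]"

definition M_d :: "int vec \<Rightarrow> int vec" where
  "M_d x = vec_of_list
     [x $ 1 - x $ 0, x $ 0, x $ 3 - x $ 2, x $ 2, x $ 5 - x $ 4, x $ 4, x $ 6]"

definition delta_vec :: "int vec" where
  "delta_vec = vec_of_list [1, 2, 1, 2, 1, 2, 3]"

text \<open>Entry \<open>r - 1\<close> of the list is \<open>v\<^sub>r\<close>.\<close>

definition v_vec :: "nat \<Rightarrow> int vec" where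
  "v_vec r = vec_of_list
     ([[0, 0, 0, 0, 0, 0, 1],
       [0, 1, 0, 1, 0, 1, 1],
       [1, 1, 1, 1, 1, 1, 2],
       [1, 2, 1, 2, 1, 2, 2]] ! (r - 1))"

text \<open>For \<open>k \<ge> 1\<close>, the numbers \<open>q = (k - 1) div 4\<close> and \<open>r = (k - 1) mod 4 + 1\<close> are the unique ones
  with \<open>k = 4 * q + r\<close> and \<open>1 \<le> r \<le> 4\<close>.\<close>

definition d_vec :: "nat \<Rightarrow> int vec" where
  "d_vec k = v_vec ((k - 1) mod 4 + 1) + int ((k - 1) div 4) \<cdot>\<^sub>v delta_vec"

definition D_3 :: "real mat" where
  "D_3 = mat_of_rows_list 7
     [[-1, 1,  0, 0,  0, 0,  0],
      [-1, 1,  0, 1,  0, 1, -1],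
      [ 0, 0, -1, 1,  0, 0,  0],
      [ 0, 1, -1, 1,  0, 1, -1],
      [ 0, 0,  0, 0, -1, 1,  0],
      [ 0, 1,  0, 1, -1, 1, -1],
      [-1, 2, -1, 2, -1, 2, -2]]"

text \<open>Meaningful only for \<open>k \<ge> 4\<close>, where the subtraction \<open>k div 2 - 2\<close> does not truncate.\<close>

definition D_map :: "nat \<Rightarrow> real vec \<Rightarrow> real vec" where
  "D_map k =
     (if even k then (\<lambda>x. D_3 *\<^sub>v x) \<circ> (coxeter ^^ (k div 2 - 2)) \<circ> M_f
      else (\<lambda>x. D_3 *\<^sub>v x) \<circ> (coxeter ^^ (k div 2 - 2)) \<circ> c_circ \<circ> M_f)"

end

theory Submission
  imports Defs
begin

text \<open>A representation of the algebra on \<open>\<complex>\<^sup>n\<close> is a family of six Hermitian projections \<open>p g\<close>, orthogonal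
  in pairs along each branch, whose weighted sum \<open>\<Sum>g. a g * p g\<close> is the scalar \<open>\<gamma>\<close>. Two constructions
  turn an irreducible family into another irreducible family.

  The reflection at the odd vertices replaces the first projection of every branch by
  \<open>1 - p\<^sub>1 - p\<^sub>2\<close>; in terms of the operator \<open>A = \<alpha>\<^sub>1 p\<^sub>1 + \<alpha>\<^sub>2 p\<^sub>2\<close> it passes from \<open>A\<close> to
  \<open>\<alpha>\<^sub>1 - A\<close>. On the weights, read through \<open>M_f\<close>, it is \<open>c_bullet\<close> (\<open>e6_system_reflect_odd\<close>).

  For the reflection at the even vertices, put the maps \<open>sqrt (a g) * p g\<close> side by side. They form an
  operator \<open>\<Gamma>\<close> from the direct sum of the ranges onto \<open>\<complex>\<^sup>n\<close> with \<open>\<Gamma> \<Gamma>\<^sup>* = \<gamma>\<close>. Compressing the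
  projections onto the summands to the kernel of \<open>\<Gamma>\<close>, a space of dimension
  \<open>(\<Sum>g. rank (p g)) - n\<close>, gives up to scalar factors projections of the same ranks whose sum with the
  weights \<open>\<gamma> - a g\<close> is again \<open>\<gamma>\<close>. On the
  weights this is \<open>c_circ\<close> (\<open>hyperbolic_reflection\<close>, \<open>e6_system_reflect_even\<close>). It requires
  \<open>a g < \<gamma>\<close>, which an irreducible family with positive weights on a space of dimension at least two
  satisfies for every nonzero \<open>p g\<close>: otherwise a vector in the range of \<open>p g\<close> is killed by all other projections and
  spans an invariant line (\<open>irreducible_weight_bound\<close>).

  The dimension vectors \<open>M_d d\<^sub>k\<close> form one chain under the alternating reflections, and the reflections
  are involutions on the weights. Hence a family at level \<open>k\<close> exists for the weights \<open>M_f \<chi>\<close> if and only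
  if a family at level \<open>4\<close> exists for the weights reflected \<open>k - 4\<close> times, which is the vector to which
  \<open>D_3\<close> is applied in \<open>D_map k\<close> (\<open>realizable_step\<close>, \<open>realizable_iff_D_map\<close>).

  At level \<open>4\<close> the space is two-dimensional and all six projections have rank one
  (\<open>realizable_4_iff\<close>). Odd rows of \<open>D_3\<close> other than the last are the smaller weights, and the last row
  is the trace of the weighted sum. When the last row vanishes, the even rows are a strict triangle inequality between the gaps
  \<open>\<alpha>\<^sub>1 - \<alpha>\<^sub>2\<close>, \<open>\<beta>\<^sub>1 - \<beta>\<^sub>2\<close>, \<open>\<delta>\<^sub>1 - \<delta>\<^sub>2\<close>: after one odd reflection to level \<open>3\<close> it is the bound of the
  weights by the central value. Conversely, the triangle inequality makes the weights of level \<open>3\<close> an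
  even reflection of positive weights on a one-dimensional space, where the existence is obvious; so
  no matrices of size two have to be written down.\<close>

section \<open>Hermitian idempotents and their ranks\<close>

text \<open>The kernel \<open>E\<close> is the orthogonal projection onto a subspace of \<open>\<complex>\<^sup>I\<close>, and \<open>v\<close> lists an orthonormal
  basis of that subspace. A nonzero column of \<open>E\<close>, normalised, is a unit vector in the range;
  splitting it off leaves a projection whose trace is smaller by one, so the process stops. An
  arbitrary index set keeps block operators free of index arithmetic.\<close>

lemma hermitian_idempotent_factorization:
  fixes E :: "'i \<Rightarrow> 'i \<Rightarrow> complex"
  assumes fin: "finite I"
    and herm: "\<And>x y. x \<in> I \<Longrightarrow> y \<in> I \<Longrightarrow> E y x = cnj (E x y)"
    and idem: "\<And>x y. x \<in> I \<Longrightarrow> y \<in> I \<Longrightarrow> (\<Sum>z\<in>I. E x z * E z y) = E x y"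
  shows "\<exists>(m::nat) v. (\<forall>x\<in>I. \<forall>y\<in>I. E x y = (\<Sum>l<m. v x l * cnj (v y l))) \<and>
    (\<forall>l<m. \<forall>l'<m. (\<Sum>x\<in>I. cnj (v x l) * v x l') = (if l = l' then 1 else 0))"
proof -
  have diag: "E x x = of_real (\<Sum>z\<in>I. (cmod (E x z))\<^sup>2)"
    if "x \<in> I" and h: "\<And>x y. x \<in> I \<Longrightarrow> y \<in> I \<Longrightarrow> E y x = cnj (E x y)"
      and i: "\<And>x y. x \<in> I \<Longrightarrow> y \<in> I \<Longrightarrow> (\<Sum>z\<in>I. E x z * E z y) = E x y"
    for x and E :: "'i \<Rightarrow> 'i \<Rightarrow> complex"
  proof -
    have "E x x = (\<Sum>z\<in>I. E x z * cnj (E x z))"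
      using i[OF that(1) that(1)] h[OF that(1)] by simp
    then show ?thesis by (simp add: complex_norm_square[symmetric])
  qed
  obtain N :: nat where "Re (\<Sum>x\<in>I. E x x) < real N"
    using reals_Archimedean2 by blast
  with herm idem show ?thesis
  proof (induction N arbitrary: E)
    case 0
    have "Re (\<Sum>x\<in>I. E x x) = (\<Sum>x\<in>I. \<Sum>z\<in>I. (cmod (E x z))\<^sup>2)"
      by (simp add: diag[OF _ 0(1,2)])
    then have "Re (\<Sum>x\<in>I. E x x) \<ge> 0" by (simp add: sum_nonneg)
    with 0(3) show ?case by simp
  next
    case (Suc N E)
    note h = Suc.prems(1) and i = Suc.prems(2)
    have hc: "cnj (E x y) = E y x" if "x \<in> I" "y \<in> I" for x y
      using h[OF that] by simp
    show ?case
    proof (cases "\<forall>x\<in>I. \<forall>y\<in>I. E x y = 0")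
      case True
      then show ?thesis by (intro exI[of _ "0::nat"]) simp
    next
      case False
      then obtain x0 y0 where xy: "x0 \<in> I" "y0 \<in> I" "E y0 x0 \<noteq> 0" by blast
      define s where "s = (\<Sum>z\<in>I. (cmod (E y0 z))\<^sup>2)"
      have s0: "s > 0" unfolding s_def
        using xy fin by (intro sum_pos2[of I x0]) auto
      have Es: "E y0 y0 = of_real s" unfolding s_def by (rule diag[OF xy(2) h i])
      define t where "t = complex_of_real (sqrt s)"
      have t: "t \<noteq> 0" "cnj t = t" "t * t = of_real s"
        using s0 by (auto simp: t_def simp flip: of_real_mult)
      \<comment> \<open>\<open>E\<close> is a Hermitian idempotent, so its column at \<open>y0\<close> has squared norm \<open>E y0 y0\<close>.\<close>
      define e where "e x = E x y0 / t" for x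
      have Ee: "(\<Sum>z\<in>I. E x z * e z) = e x" if "x \<in> I" for x
        using i[OF that xy(2)] by (simp add: e_def flip: sum_divide_distrib)
      have cE: "(\<Sum>z\<in>I. cnj (e z) * E z y) = cnj (e y)" if "y \<in> I" for y
      proof -
        have "(\<Sum>z\<in>I. cnj (e z) * E z y) = (\<Sum>z\<in>I. cnj (E y z * e z))"
          using that by (intro sum.cong) (auto simp: hc mult.commute)
        also have "\<dots> = cnj (e y)" by (simp only: Ee[OF that] flip: cnj_sum)
        finally show ?thesis .
      qed
      have ee: "(\<Sum>z\<in>I. cnj (e z) * e z) = 1"
      proof -
        have "(\<Sum>z\<in>I. cnj (e z) * e z) = (\<Sum>z\<in>I. E y0 z * E z y0 / (t * t))"
          using xy(2) t(2) by (intro sum.cong) (auto simp: e_def hc)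
        also have "\<dots> = E y0 y0 / (t * t)"
          by (simp only: i[OF xy(2) xy(2)] flip: sum_divide_distrib)
        finally show ?thesis using t s0 by (simp add: Es)
      qed
      define E' where "E' x y = E x y - e x * cnj (e y)" for x y
      have h': "E' y x = cnj (E' x y)" if "x \<in> I" "y \<in> I" for x y
        by (simp add: E'_def hc[OF that])
      have i': "(\<Sum>z\<in>I. E' x z * E' z y) = E' x y" if "x \<in> I" "y \<in> I" for x y
      proof -
        have "(\<Sum>z\<in>I. E' x z * E' z y) = (\<Sum>z\<in>I. E x z * E z y - (E x z * e z) * cnj (e y)
            - e x * (cnj (e z) * E z y) + e x * (cnj (e z) * e z) * cnj (e y))"
          by (intro sum.cong) (auto simp: E'_def algebra_simps)
        also have "\<dots> = E x y - e x * cnj (e y) - e x * cnj (e y) + e x * 1 * cnj (e y)"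
          using that by (simp add: sum.distrib sum_subtractf Ee cE i ee
              flip: sum_distrib_left sum_distrib_right)
        finally show ?thesis by (simp add: E'_def)
      qed
      have tr: "Re (\<Sum>x\<in>I. E' x x) < real N"
      proof -
        have "(\<Sum>x\<in>I. E' x x) = (\<Sum>x\<in>I. E x x) - 1"
          using ee by (simp add: E'_def sum_subtractf mult.commute)
        with Suc.prems(3) show ?thesis by simp
      qed
      obtain m :: nat and v where v: "\<And>x y. x \<in> I \<Longrightarrow> y \<in> I \<Longrightarrow> E' x y = (\<Sum>l<m. v x l * cnj (v y l))"
        and o: "\<And>l l'. l < m \<Longrightarrow> l' < m \<Longrightarrow>
          (\<Sum>x\<in>I. cnj (v x l) * v x l') = (if l = l' then 1 else 0)"
        using Suc.IH[OF h' i' tr] by blast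
      have E'e: "(\<Sum>y\<in>I. E' x y * e y) = 0" if "x \<in> I" for x
      proof -
        have "(\<Sum>y\<in>I. E' x y * e y) = (\<Sum>y\<in>I. E x y * e y - e x * (cnj (e y) * e y))"
          by (intro sum.cong) (auto simp: E'_def algebra_simps)
        also have "\<dots> = e x - e x * 1"
          using that by (simp add: sum_subtractf Ee ee flip: sum_distrib_left)
        finally show ?thesis by simp
      qed
      have ve: "(\<Sum>y\<in>I. cnj (v y l) * e y) = 0" if "l < m" for l
      proof -
        have "0 = (\<Sum>x\<in>I. cnj (v x l) * (\<Sum>y\<in>I. E' x y * e y))" by (simp add: E'e)
        also have "\<dots> = (\<Sum>x\<in>I. cnj (v x l) * (\<Sum>y\<in>I. \<Sum>l'<m. v x l' * (cnj (v y l') * e y)))"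
          by (intro sum.cong refl arg_cong2[where f = "(*)"])
             (simp_all add: v sum_distrib_right mult.assoc)
        also have "\<dots> = (\<Sum>x\<in>I. \<Sum>l'<m. cnj (v x l) * v x l' * (\<Sum>y\<in>I. cnj (v y l') * e y))"
          by (subst sum.swap[of _ "{..<m}" I]) (simp add: sum_distrib_left mult.assoc)
        also have "\<dots> = (\<Sum>l'<m. (\<Sum>x\<in>I. cnj (v x l) * v x l') * (\<Sum>y\<in>I. cnj (v y l') * e y))"
          by (subst sum.swap) (simp add: sum_distrib_right)
        also have "\<dots> = (\<Sum>l'<m. if l = l' then (\<Sum>y\<in>I. cnj (v y l') * e y) else 0)"
          by (intro sum.cong) (auto simp: o that)
        also have "\<dots> = (\<Sum>y\<in>I. cnj (v y l) * e y)" using that by simp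
        finally show ?thesis by simp
      qed
      have ev: "(\<Sum>y\<in>I. cnj (e y) * v y l) = 0" if "l < m" for l
      proof -
        have "(\<Sum>y\<in>I. cnj (e y) * v y l) = cnj (\<Sum>y\<in>I. cnj (v y l) * e y)"
          by (simp add: mult.commute)
        then show ?thesis by (simp only: ve[OF that] complex_cnj_zero)
      qed
      define w where "w x l = (if l < m then v x l else e x)" for x l
      show ?thesis
      proof (intro exI[of _ "Suc m"] exI[of _ w] conjI ballI allI impI)
        fix x y assume "x \<in> I" "y \<in> I"
        then show "E x y = (\<Sum>l<Suc m. w x l * cnj (w y l))"
          using v[of x y] by (simp add: w_def E'_def algebra_simps)
      next
        fix l l' assume l: "l < Suc m" "l' < Suc m"
        consider "l < m" "l' < m" | "l < m" "l' = m" | "l = m" "l' < m" | "l = m" "l' = m"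
          using l by linarith
        then show "(\<Sum>x\<in>I. cnj (w x l) * w x l') = (if l = l' then 1 else 0)"
          by cases (auto simp: w_def o ve ev ee)
      qed
    qed
  qed
qed

lemma dim_mat_adjoint [simp]:
  "dim_row (mat_adjoint A) = dim_col A" "dim_col (mat_adjoint A) = dim_row A"
  by (auto simp: mat_adjoint_def)

lemma index_mat_adjoint [simp]:
  "i < dim_col A \<Longrightarrow> j < dim_row A \<Longrightarrow> mat_adjoint A $$ (i, j) = cnj (A $$ (j, i))"
  by (auto simp: mat_adjoint_def mat_of_rows_def)

lemma mat_adjoint_carrier [simp]:
  "A \<in> carrier_mat nr nc \<Longrightarrow> mat_adjoint (A :: complex mat) \<in> carrier_mat nc nr"
  by auto

lemma mat_adjoint_mat_adjoint [simp]: "mat_adjoint (mat_adjoint A) = (A :: complex mat)"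
  by (rule eq_matI) auto

lemma mat_adjoint_mult:
  assumes "A \<in> carrier_mat nr n" "B \<in> carrier_mat n nc"
  shows "mat_adjoint (A * B) = mat_adjoint B * mat_adjoint (A :: complex mat)"
  using assms by (intro eq_matI) (auto simp: scalar_prod_def intro!: sum.cong)

lemma mat_adjoint_smult: "mat_adjoint (c \<cdot>\<^sub>m A) = cnj c \<cdot>\<^sub>m mat_adjoint A"
  by (rule eq_matI) auto

definition mat_trace :: "complex mat \<Rightarrow> complex" where
  "mat_trace A = (\<Sum>i<dim_row A. A $$ (i, i))"

lemma mat_trace_mult_commute:
  assumes "A \<in> carrier_mat n m" "B \<in> carrier_mat m n"
  shows "mat_trace (A * B) = mat_trace (B * A)"
proof -
  have "mat_trace (A * B) = (\<Sum>i<n. \<Sum>j<m. A $$ (i, j) * B $$ (j, i))"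
    using assms by (auto simp: mat_trace_def scalar_prod_def atLeast0LessThan intro!: sum.cong)
  also have "\<dots> = (\<Sum>j<m. \<Sum>i<n. B $$ (j, i) * A $$ (i, j))"
    by (subst sum.swap) (simp add: mult.commute)
  also have "\<dots> = mat_trace (B * A)"
    using assms by (auto simp: mat_trace_def scalar_prod_def atLeast0LessThan intro!: sum.cong)
  finally show ?thesis .
qed

text \<open>The operators \<open>V V\<^sup>*\<close> and \<open>V\<close> have the same range, and an isometry has linearly independent
  columns.\<close>

lemma rank_isometry_range:
  fixes V :: "complex mat"
  assumes V: "V \<in> carrier_mat n r" and iso: "mat_adjoint V * V = 1\<^sub>m r"
  shows "vec_space.rank n (V * mat_adjoint V) = r"
proof -
  interpret vec_space "TYPE(complex)" n .
  let ?P = "V * mat_adjoint V"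
  have P: "?P \<in> carrier_mat n n" using V by auto
  have inj: "x = y" if "x \<in> carrier_vec r" "y \<in> carrier_vec r" "V *\<^sub>v x = V *\<^sub>v y" for x y
  proof -
    have "(mat_adjoint V * V) *\<^sub>v x = (mat_adjoint V * V) *\<^sub>v y"
      using that assoc_mult_mat_vec[OF mat_adjoint_carrier[OF V] V] by simp
    then show ?thesis using that by (simp add: iso)
  qed
  have "?P *\<^sub>v y = V *\<^sub>v (mat_adjoint V *\<^sub>v y)" if "y \<in> carrier_vec n" for y
    using assoc_mult_mat_vec[OF V mat_adjoint_carrier[OF V] that] .
  moreover have "V *\<^sub>v y = ?P *\<^sub>v (V *\<^sub>v y)" if y: "y \<in> carrier_vec r" for y
  proof -
    have "?P *\<^sub>v (V *\<^sub>v y) = V *\<^sub>v (mat_adjoint V *\<^sub>v (V *\<^sub>v y))"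
      by (rule assoc_mult_mat_vec[OF V mat_adjoint_carrier[OF V]]) (use V y in auto)
    also have "mat_adjoint V *\<^sub>v (V *\<^sub>v y) = y"
      using assoc_mult_mat_vec[OF mat_adjoint_carrier[OF V] V y] y by (simp add: iso)
    finally show ?thesis by simp
  qed
  moreover have "mat_adjoint V *\<^sub>v y \<in> carrier_vec r" if "y \<in> carrier_vec n" for y
    using mult_mat_vec_carrier[OF mat_adjoint_carrier[OF V] that] .
  moreover have "V *\<^sub>v y \<in> carrier_vec n" if "y \<in> carrier_vec r" for y
    using V that by auto
  moreover have "dim_row ?P = n" "dim_col ?P = n" "dim_row V = n" "dim_col V = r"
    using V by auto
  ultimately have "col_space ?P = col_space V"
    unfolding col_space_eq[OF P] col_space_eq[OF V] by (metis (no_types, lifting))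
  then have "rank ?P = rank V" unfolding rank_def col_space_def by simp
  also have "rank V = r"
  proof (rule lin_indpt_full_rank[OF V])
    have c: "cols V ! j = V *\<^sub>v unit_vec r j" if "j < r" for j
      using V that by (intro eq_vecI) (auto simp: scalar_prod_right_unit)
    show d: "distinct (cols V)"
      unfolding distinct_conv_nth
    proof (intro allI impI notI)
      fix i j assume ij: "i < length (cols V)" "j < length (cols V)" "i \<noteq> j" "cols V ! i = cols V ! j"
      have r: "i < r" "j < r" using ij V by simp_all
      have "V *\<^sub>v unit_vec r i = V *\<^sub>v unit_vec r j"
        using ij(4) unfolding c[OF r(1)] c[OF r(2)] .
      then have "unit_vec r i = (unit_vec r j :: complex vec)" by (rule inj[rotated 2]) simp_all
      then have "unit_vec r i $ i = (unit_vec r j $ i :: complex)" by simp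
      with ij(3) r show False by simp
    qed
    show "lin_indpt (set (cols V))"
    proof
      assume "lin_dep (set (cols V))"
      then obtain v where "v \<in> carrier_vec r" "v \<noteq> 0\<^sub>v r" "V *\<^sub>v v = 0\<^sub>v n"
        by (rule lin_depE[OF V _ d])
      moreover have "V *\<^sub>v 0\<^sub>v r = 0\<^sub>v n" using V by auto
      ultimately show False using inj[of v "0\<^sub>v r"] by auto
    qed
  qed
  finally show ?thesis .
qed

text \<open>Ranks enter the argument only through traces, which are additive and computable; this lemma
  translates them back.\<close>

lemma trace_projection:
  fixes P :: "complex mat"
  assumes P: "P \<in> carrier_mat n n" and h: "mat_adjoint P = P" and i: "P * P = P"
  shows "mat_trace P = of_nat (vec_space.rank n P)"
proof -
  have "\<exists>(m::nat) v. (\<forall>x\<in>{..<n}. \<forall>y\<in>{..<n}. P $$ (x, y) = (\<Sum>l<m. v x l * cnj (v y l))) \<and>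
    (\<forall>l<m. \<forall>l'<m. (\<Sum>x<n. cnj (v x l) * v x l') = (if l = l' then 1 else 0))"
  proof (rule hermitian_idempotent_factorization)
    fix x y assume xy: "x \<in> {..<n}" "y \<in> {..<n}"
    have "P $$ (y, x) = mat_adjoint P $$ (y, x)" by (simp add: h)
    then show "P $$ (y, x) = cnj (P $$ (x, y))" using P xy by simp
    have "P $$ (x, y) = (P * P) $$ (x, y)" by (simp add: i)
    then show "(\<Sum>z<n. P $$ (x, z) * P $$ (z, y)) = P $$ (x, y)"
      using P xy by (simp add: scalar_prod_def atLeast0LessThan)
  qed simp
  then obtain m :: nat and v where v: "\<And>x y. x < n \<Longrightarrow> y < n \<Longrightarrow> P $$ (x, y) = (\<Sum>l<m. v x l * cnj (v y l))"
    and o: "\<And>l l'. l < m \<Longrightarrow> l' < m \<Longrightarrow> (\<Sum>x<n. cnj (v x l) * v x l') = (if l = l' then 1 else 0)"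
    unfolding Ball_def lessThan_iff by (elim exE conjE) blast
  define V where "V = mat n m (\<lambda>(x, l). v x l)"
  have V: "V \<in> carrier_mat n m" by (simp add: V_def)
  have PV: "P = V * mat_adjoint V"
    using P by (intro eq_matI) (auto simp: V_def v scalar_prod_def atLeast0LessThan)
  have VV: "mat_adjoint V * V = 1\<^sub>m m"
    by (intro eq_matI) (auto simp: V_def o scalar_prod_def atLeast0LessThan)
  have "mat_trace P = mat_trace (1\<^sub>m m)"
    unfolding PV VV[symmetric] by (rule mat_trace_mult_commute[OF V]) (use V in auto)
  also have "\<dots> = of_nat m" by (simp add: mat_trace_def)
  finally show ?thesis using rank_isometry_range[OF V VV] by (simp add: PV)
qed

section \<open>Projections with a scalar weighted sum\<close>

lemma index_mult_mat_sum:
  assumes "A \<in> carrier_mat nr n" "B \<in> carrier_mat n nc" "i < nr" "j < nc"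
  shows "(A * B) $$ (i, j) = (\<Sum>l<n. A $$ (i, l) * B $$ (l, j))"
  using assms by (simp add: scalar_prod_def atLeast0LessThan)

text \<open>Entrywise, because the type of matrices of all sizes carries no zero and hence no finite sums.\<close>

definition sums_to :: "nat \<Rightarrow> complex \<Rightarrow> ('g::finite \<Rightarrow> complex mat) \<Rightarrow> bool" where
  "sums_to n c F \<longleftrightarrow> (\<forall>g. F g \<in> carrier_mat n n) \<and>
     (\<forall>i<n. \<forall>j<n. (\<Sum>g\<in>UNIV. F g $$ (i, j)) = (if i = j then c else 0))"

lemma sums_to_mult_left:
  assumes F: "sums_to n c F" and B: "B \<in> carrier_mat n k" and ij: "i < n" "j < k"
  shows "(\<Sum>g\<in>UNIV. (F g * B) $$ (i, j)) = c * B $$ (i, j)"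
proof -
  have d: "dim_row (F g) = n" "dim_col (F g) = n" for g
    using F by (auto simp: sums_to_def)
  have "(\<Sum>g\<in>UNIV. (F g * B) $$ (i, j)) = (\<Sum>g\<in>UNIV. \<Sum>l<n. F g $$ (i, l) * B $$ (l, j))"
    using B ij d by (auto simp: scalar_prod_def atLeast0LessThan)
  also have "\<dots> = (\<Sum>l<n. (\<Sum>g\<in>UNIV. F g $$ (i, l)) * B $$ (l, j))"
    by (subst sum.swap) (simp add: sum_distrib_right)
  also have "\<dots> = (\<Sum>l<n. if i = l then c * B $$ (l, j) else 0)"
    using F ij by (intro sum.cong) (auto simp: sums_to_def)
  also have "\<dots> = c * B $$ (i, j)" using ij by simp
  finally show ?thesis .
qed

lemma sums_to_sandwich:
  assumes F: "sums_to n c F" and B: "B \<in> carrier_mat k n" and C: "C \<in> carrier_mat n k'"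
    and ij: "i < k" "j < k'"
  shows "(\<Sum>g\<in>UNIV. (B * (F g * C)) $$ (i, j)) = c * (B * C) $$ (i, j)"
proof -
  have FC: "F g * C \<in> carrier_mat n k'" for g
    using F C mult_carrier_mat[of "F g" n n C k'] by (auto simp: sums_to_def)
  have "(\<Sum>g\<in>UNIV. (B * (F g * C)) $$ (i, j)) =
      (\<Sum>g\<in>UNIV. \<Sum>l<n. B $$ (i, l) * (F g * C) $$ (l, j))"
    by (simp only: index_mult_mat_sum[OF B FC ij])
  also have "\<dots> = (\<Sum>l<n. B $$ (i, l) * (\<Sum>g\<in>UNIV. (F g * C) $$ (l, j)))"
    by (subst sum.swap) (simp add: sum_distrib_left)
  also have "\<dots> = (\<Sum>l<n. B $$ (i, l) * (c * C $$ (l, j)))"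
    by (rule sum.cong) (simp_all only: lessThan_iff sums_to_mult_left[OF F C _ ij(2)])
  also have "\<dots> = c * (B * C) $$ (i, j)"
    using B C ij by (simp add: scalar_prod_def atLeast0LessThan sum_distrib_left mult.left_commute)
  finally show ?thesis .
qed

lemma sums_to_mult_vec:
  assumes F: "sums_to n c F" and w: "w \<in> carrier_vec n" and i: "i < n"
  shows "(\<Sum>g\<in>UNIV. (F g *\<^sub>v w) $ i) = c * w $ i"
proof -
  have d: "dim_row (F g) = n" "dim_col (F g) = n" for g
    using F by (auto simp: sums_to_def)
  have "(\<Sum>g\<in>UNIV. (F g *\<^sub>v w) $ i) = (\<Sum>g\<in>UNIV. \<Sum>l<n. F g $$ (i, l) * w $ l)"
    using w i d by (auto simp: scalar_prod_def atLeast0LessThan)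
  also have "\<dots> = (\<Sum>l<n. (\<Sum>g\<in>UNIV. F g $$ (i, l)) * w $ l)"
    by (subst sum.swap) (simp add: sum_distrib_right)
  also have "\<dots> = (\<Sum>l<n. if i = l then c * w $ l else 0)"
    using F i by (intro sum.cong) (auto simp: sums_to_def)
  also have "\<dots> = c * w $ i" using i by simp
  finally show ?thesis .
qed

lemma sums_to_trace:
  assumes F: "sums_to n c F"
  shows "(\<Sum>g\<in>UNIV. mat_trace (F g)) = of_nat n * c"
proof -
  have "dim_row (F g) = n" for g using F by (auto simp: sums_to_def)
  then have "(\<Sum>g\<in>UNIV. mat_trace (F g)) = (\<Sum>i<n. \<Sum>g\<in>UNIV. F g $$ (i, i))"
    by (subst sum.swap) (simp add: mat_trace_def)
  also have "\<dots> = (\<Sum>i<n. c)" using F by (intro sum.cong) (auto simp: sums_to_def)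
  finally show ?thesis by simp
qed

definition vec_subspace :: "nat \<Rightarrow> complex vec set \<Rightarrow> bool" where
  "vec_subspace n W \<longleftrightarrow> W \<subseteq> carrier_vec n \<and> 0\<^sub>v n \<in> W \<and>
     (\<forall>x\<in>W. \<forall>y\<in>W. x + y \<in> W) \<and> (\<forall>c. \<forall>x\<in>W. c \<cdot>\<^sub>v x \<in> W)"

lemma vec_subspace_sum:
  assumes W: "vec_subspace n W" and "finite S" "\<And>g. g \<in> S \<Longrightarrow> f g \<in> W"
  shows "vec n (\<lambda>i. \<Sum>g\<in>S. f g $ i) \<in> W"
  using assms(2,3)
proof (induction S rule: finite_induct)
  case empty
  have "vec n (\<lambda>i. \<Sum>g\<in>{}. f g $ i) = 0\<^sub>v n" by (intro eq_vecI) auto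
  with W show ?case by (simp add: vec_subspace_def)
next
  case (insert g S)
  have c: "f g \<in> carrier_vec n" using insert.prems W by (auto simp: vec_subspace_def)
  have "vec n (\<lambda>i. \<Sum>g\<in>insert g S. f g $ i) = f g + vec n (\<lambda>i. \<Sum>g\<in>S. f g $ i)"
    using insert.hyps c by (intro eq_vecI) auto
  with insert W show ?case by (auto simp: vec_subspace_def)
qed

definition irreducible_family :: "nat \<Rightarrow> ('g \<Rightarrow> complex mat) \<Rightarrow> bool" where
  "irreducible_family n p \<longleftrightarrow> n > 0 \<and>
     (\<forall>W. vec_subspace n W \<and> (\<forall>g. \<forall>w\<in>W. p g *\<^sub>v w \<in> W) \<longrightarrow>
        W = {0\<^sub>v n} \<or> W = carrier_vec n)"

definition projection_family :: "nat \<Rightarrow> ('g \<Rightarrow> complex mat) \<Rightarrow> bool" where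
  "projection_family n p \<longleftrightarrow>
     (\<forall>g. p g \<in> carrier_mat n n \<and> mat_adjoint (p g) = p g \<and> p g * p g = p g)"

text \<open>Let \<open>\<Gamma>\<close> be the row of the blocks \<open>sqrt (a g) * p g\<close>. Then \<open>\<Gamma>\<^sup>* \<Gamma> / \<gamma>\<close> is a projection below the block
  diagonal projection of the \<open>p g\<close>, so that their difference \<open>E\<close> is a projection too. Its range is
  the kernel of \<open>\<Gamma>\<close> inside the direct sum of the ranges, and \<open>V g\<close> is the block \<open>g\<close> of the inclusion of
  this kernel: the second conclusion is \<open>V\<^sup>* V = 1\<close>, the last two are the blocks of \<open>V V\<^sup>* = E\<close>.\<close>

lemma complementary_frame:
  fixes p :: "'g::finite \<Rightarrow> complex mat"
  assumes p: "projection_family n p"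
    and sum: "sums_to n (of_real \<gamma>) (\<lambda>g. of_real (a g) \<cdot>\<^sub>m p g)"
    and a: "\<And>g. 0 < a g" and \<gamma>: "0 < \<gamma>"
  obtains m V where "\<And>g. V g \<in> carrier_mat n m"
    and "sums_to m 1 (\<lambda>g. mat_adjoint (V g) * V g)"
    and "\<And>g. V g * mat_adjoint (V g) = complex_of_real (1 - a g / \<gamma>) \<cdot>\<^sub>m p g"
    and "\<And>g h. g \<noteq> h \<Longrightarrow>
      V g * mat_adjoint (V h) = complex_of_real (- (sqrt (a g * a h) / \<gamma>)) \<cdot>\<^sub>m (p g * p h)"
proof -
  have pc: "p g \<in> carrier_mat n n" and pa: "mat_adjoint (p g) = p g" and pp: "p g * p g = p g" for g
    using p by (auto simp: projection_family_def)
  have pd [simp]: "dim_row (p g) = n" "dim_col (p g) = n" for g using pc[of g] by auto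
  define c where "c g h = sqrt (a g * a h) / \<gamma>" for g h
  have cc: "c g k * c k h = c g h * a k / \<gamma>" for g k h
    using a[of k] \<gamma> by (simp add: c_def real_sqrt_mult field_simps)
  have c_same: "c g g = a g / \<gamma>" for g using a[of g] by (simp add: c_def)
  define q where "q g h = p g * p h" for g h
  define t where "t g k h = p g * p k * p h" for g k h
  have qc: "q g h \<in> carrier_mat n n" for g h by (simp add: q_def mult_carrier_mat[OF pc pc])
  have qd [simp]: "dim_row (q g h) = n" "dim_col (q g h) = n" for g h using qc[of g h] by auto
  have tc: "t g k h \<in> carrier_mat n n" for g h k by (simp add: t_def mult_carrier_mat[OF mult_carrier_mat[OF pc pc] pc])
  have assoc: "p g * p k * p h = p g * (p k * p h)" for g k h by (rule assoc_mult_mat[OF pc pc pc])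
  have t1: "p g * q k h = t g k h" and t2: "q g k * p h = t g k h"
    and t4: "t g g h = q g h" and t5: "t g h h = q g h" for g k h
    by (simp_all add: q_def t_def assoc pp)
  have t3: "q g k * q k h = t g k h" for g k h
  proof -
    have "q g k * q k h = p g * (p k * q k h)"
      unfolding q_def[of g k] by (rule assoc_mult_mat[OF pc pc qc])
    then show ?thesis by (simp add: t1 t4)
  qed
  \<comment> \<open>Rows and columns of the block operators are indexed by a generator and a coordinate.\<close>
  define E where "E x y = (if fst x = fst y then p (fst x) $$ (snd x, snd y) else 0)
      - of_real (c (fst x) (fst y)) * q (fst x) (fst y) $$ (snd x, snd y)" for x y
  let ?I = "(UNIV :: 'g set) \<times> {..<n}"
  have "\<exists>(m::nat) v. (\<forall>x\<in>?I. \<forall>y\<in>?I. E x y = (\<Sum>l<m. v x l * cnj (v y l))) \<and>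
    (\<forall>l<m. \<forall>l'<m. (\<Sum>x\<in>?I. cnj (v x l) * v x l') = (if l = l' then 1 else 0))"
  proof (rule hermitian_idempotent_factorization)
    show "finite ?I" by simp
    fix x y assume xy: "x \<in> ?I" "y \<in> ?I"
    obtain g i where x: "x = (g, i)" "i < n" using xy by auto
    obtain h j where y: "y = (h, j)" "j < n" using xy by auto
    have pij: "p g $$ (j, i) = cnj (p g $$ (i, j))"
      using index_mat_adjoint[of j "p g" i] x y by (simp add: pa)
    have "q h g = mat_adjoint (q g h)"
      unfolding q_def by (subst mat_adjoint_mult[OF pc pc]) (simp add: pa)
    then have "q h g $$ (j, i) = cnj (q g h $$ (i, j))" using x y by simp
    then show "E y x = cnj (E x y)"
      using pij by (simp add: E_def x y c_def mult.commute)
    have "(\<Sum>z\<in>?I. E x z * E z y) = (\<Sum>k\<in>UNIV. \<Sum>l<n. E x (k, l) * E (k, l) y)"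
      by (simp add: sum.cartesian_product)
    also have "\<dots> = (\<Sum>k\<in>UNIV. (if g = k then if g = h then p g $$ (i, j) else 0 else 0)
        - (if g = k then of_real (c g h) * q g h $$ (i, j) else 0)
        - (if k = h then of_real (c g h) * q g h $$ (i, j) else 0)
        + of_real (c g h / \<gamma>) * (of_real (a k) * t g k h $$ (i, j)))"
    proof (rule sum.cong[OF HOL.refl])
      fix k
      let ?cg = "complex_of_real (c g k)" and ?ch = "complex_of_real (c k h)"
      have "(\<Sum>l<n. E x (k, l) * E (k, l) y) = (\<Sum>l<n.
          (if g = k \<and> k = h then p g $$ (i, l) * p k $$ (l, j) else 0)
          - (if g = k then ?ch * (p g $$ (i, l) * q k h $$ (l, j)) else 0)
          - (if k = h then ?cg * (q g k $$ (i, l) * p k $$ (l, j)) else 0)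
          + ?cg * ?ch * (q g k $$ (i, l) * q k h $$ (l, j)))"
        by (intro sum.cong) (auto simp: E_def x y algebra_simps)
      also have "\<dots> = (if g = k \<and> k = h then (p g * p k) $$ (i, j) else 0)
          - (if g = k then ?ch * (p g * q k h) $$ (i, j) else 0)
          - (if k = h then ?cg * (q g k * p k) $$ (i, j) else 0)
          + ?cg * ?ch * (q g k * q k h) $$ (i, j)"
        by (simp add: sum.distrib sum_subtractf index_mult_mat_sum[OF pc pc x(2) y(2)]
            index_mult_mat_sum[OF pc qc x(2) y(2)] index_mult_mat_sum[OF qc pc x(2) y(2)]
            index_mult_mat_sum[OF qc qc x(2) y(2)] del: index_mult_mat flip: sum_distrib_left)
      also have "\<dots> = (if g = k then if g = h then p g $$ (i, j) else 0 else 0)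
          - (if g = k then of_real (c g h) * q g h $$ (i, j) else 0)
          - (if k = h then of_real (c g h) * q g h $$ (i, j) else 0)
          + of_real (c g h / \<gamma>) * (of_real (a k) * t g k h $$ (i, j))"
        using cc[of g k h] by (auto simp: t1 t2 t3 t4 t5 pp simp flip: of_real_mult)
      finally show "(\<Sum>l<n. E x (k, l) * E (k, l) y) = \<dots>" .
    qed
    also have "\<dots> = (if g = h then p g $$ (i, j) else 0) - of_real (c g h) * q g h $$ (i, j)
        - of_real (c g h) * q g h $$ (i, j)
        + of_real (c g h / \<gamma>) * (\<Sum>k\<in>UNIV. of_real (a k) * t g k h $$ (i, j))"
      by (simp add: sum.distrib sum_subtractf sum_distrib_left sum_divide_distrib)
    also have "(\<Sum>k\<in>UNIV. of_real (a k) * t g k h $$ (i, j)) = of_real \<gamma> * q g h $$ (i, j)"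
    proof -
      have "of_real (a k) * t g k h $$ (i, j) = (p g * (of_real (a k) \<cdot>\<^sub>m p k * p h)) $$ (i, j)" for k
      proof -
        have "p g * (of_real (a k) \<cdot>\<^sub>m p k * p h) = of_real (a k) \<cdot>\<^sub>m t g k h"
          unfolding mult_smult_assoc_mat[OF pc pc] t1[symmetric] q_def
          by (rule mult_smult_distrib[OF pc]) (use pc in auto)
        then show ?thesis using x y tc[of g k h] by simp
      qed
      then show ?thesis
        using sums_to_sandwich[OF sum pc pc x(2) y(2)] by (simp add: q_def)
    qed
    finally show "(\<Sum>z\<in>?I. E x z * E z y) = E x y"
      using \<gamma> by (simp add: E_def x y)
  qed
  then obtain m :: nat and v where
    v: "\<forall>x\<in>?I. \<forall>y\<in>?I. E x y = (\<Sum>l<m. v x l * cnj (v y l))" and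
    o: "\<forall>l<m. \<forall>l'<m. (\<Sum>x\<in>?I. cnj (v x l) * v x l') = (if l = l' then 1 else 0)"
    by (elim exE conjE)
  define V where "V g = mat n m (\<lambda>(i, l). v (g, i) l)" for g
  have V: "V g \<in> carrier_mat n m" for g by (simp add: V_def)
  have VV: "(V g * mat_adjoint (V h)) $$ (i, j) = E (g, i) (h, j)" if "i < n" "j < n" for g h i j
    using that v[rule_format, of "(g, i)" "(h, j)"] by (simp add: V_def scalar_prod_def atLeast0LessThan)
  show thesis
  proof (rule that[of V m])
    show "sums_to m 1 (\<lambda>g. mat_adjoint (V g) * V g)"
      unfolding sums_to_def
    proof (intro conjI allI impI)
      fix l l' assume l: "l < m" "l' < m"
      have "(\<Sum>g\<in>UNIV. (mat_adjoint (V g) * V g) $$ (l, l')) =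
          (\<Sum>g\<in>UNIV. \<Sum>i<n. cnj (v (g, i) l) * v (g, i) l')"
        using l by (simp add: V_def scalar_prod_def atLeast0LessThan)
      also have "\<dots> = (if l = l' then 1 else 0)"
        using o[rule_format, OF l] by (simp add: sum.cartesian_product)
      finally show "(\<Sum>g\<in>UNIV. (mat_adjoint (V g) * V g) $$ (l, l')) = (if l = l' then 1 else 0)" .
    qed (rule mult_carrier_mat[OF mat_adjoint_carrier[OF V] V])
    have VVd: "dim_row (V g * mat_adjoint (V h)) = n" "dim_col (V g * mat_adjoint (V h)) = n" for g h
      using V[of g] V[of h] by simp_all
    show "V g * mat_adjoint (V g) = complex_of_real (1 - a g / \<gamma>) \<cdot>\<^sub>m p g" for g
      by (rule eq_matI)
        (simp_all add: VV VVd E_def c_same q_def pp algebra_simps del: index_mult_mat)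
    show "V g * mat_adjoint (V h) = complex_of_real (- (sqrt (a g * a h) / \<gamma>)) \<cdot>\<^sub>m (p g * p h)"
      if "g \<noteq> h" for g h
      using that by (intro eq_matI)
        (simp_all add: VV VVd E_def c_def qd[unfolded q_def] q_def del: index_mult_mat)
  qed (rule V)
qed

section \<open>The reflection at the even vertices\<close>

lemma smult_smult_mat: "c \<cdot>\<^sub>m (d \<cdot>\<^sub>m A) = (c * d) \<cdot>\<^sub>m (A :: complex mat)"
  by (rule eq_matI) (simp_all add: mult.assoc)

lemma one_smult_mat [simp]: "1 \<cdot>\<^sub>m A = (A :: complex mat)"
  by (rule eq_matI) simp_all

lemma mat_trace_smult: "A \<in> carrier_mat n n \<Longrightarrow> mat_trace (c \<cdot>\<^sub>m A) = c * mat_trace A"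
  by (auto simp: mat_trace_def sum_distrib_left)

text \<open>Compressing the projection onto the summand \<open>g\<close> to the kernel of \<open>\<Gamma>\<close> (see
  \<open>complementary_frame\<close>) gives \<open>V\<^sub>g\<^sup>* V\<^sub>g\<close>, a projection up to the factor
  \<open>1 - a g / \<gamma>\<close>; everything except irreducibility is then read off from the frame. For
  irreducibility, an invariant subspace \<open>W'\<close> is pulled back to \<open>W = {w. \<forall>g. V\<^sub>g\<^sup>* w \<in> W'}\<close>. Since the
  products \<open>p g * p h\<close> with \<open>g \<noteq> h\<close> are multiples of \<open>V\<^sub>g V\<^sub>h\<^sup>*\<close>, the space \<open>W\<close> is invariant, and since
  \<open>\<Sum>g. V\<^sub>g\<^sup>* V\<^sub>g = 1\<close>, it is trivial only if \<open>W'\<close> is.\<close>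

lemma hyperbolic_reflection:
  fixes p :: "'g::finite \<Rightarrow> complex mat"
  assumes p: "projection_family n p" and irr: "irreducible_family n p"
    and sum: "sums_to n (of_real \<gamma>) (\<lambda>g. of_real (a g) \<cdot>\<^sub>m p g)"
    and a: "\<And>g. 0 < a g" "\<And>g. a g < \<gamma>"
    and r: "\<And>g. mat_trace (p g) = of_nat (r g)" and big: "n < (\<Sum>g\<in>UNIV. r g)"
  obtains m p' where "m = (\<Sum>g\<in>UNIV. r g) - n"
    and "projection_family m p'" and "irreducible_family m p'"
    and "sums_to m (of_real \<gamma>) (\<lambda>g. of_real (\<gamma> - a g) \<cdot>\<^sub>m p' g)"
    and "\<And>g. mat_trace (p' g) = of_nat (r g)"
    and "\<And>g h. g \<noteq> h \<Longrightarrow> p g * p h = 0\<^sub>m n n \<Longrightarrow> p' g * p' h = 0\<^sub>m m m"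
proof -
  have g0: "0 < \<gamma>" using a[of undefined] by linarith
  have pc: "p g \<in> carrier_mat n n" and pa: "mat_adjoint (p g) = p g" and pp: "p g * p g = p g" for g
    using p by (auto simp: projection_family_def)
  obtain m V where V: "\<And>g. V g \<in> carrier_mat n m"
    and S: "sums_to m 1 (\<lambda>g. mat_adjoint (V g) * V g)"
    and VV: "\<And>g. V g * mat_adjoint (V g) = complex_of_real (1 - a g / \<gamma>) \<cdot>\<^sub>m p g"
    and VW: "\<And>g h. g \<noteq> h \<Longrightarrow>
      V g * mat_adjoint (V h) = complex_of_real (- (sqrt (a g * a h) / \<gamma>)) \<cdot>\<^sub>m (p g * p h)"
    by (rule complementary_frame[OF p sum a(1) g0]) (rule that)
  define U where "U g = mat_adjoint (V g)" for g
  have U: "U g \<in> carrier_mat m n" for g using V by (simp add: U_def)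
  have UV: "U g * V h \<in> carrier_mat m m" for g h using mult_carrier_mat[OF U V] .
  have VU: "V g * U h \<in> carrier_mat n n" for g h using mult_carrier_mat[OF V U] .
  have Ua: "mat_adjoint (V g) = U g" "mat_adjoint (U g) = V g" for g by (simp_all add: U_def)
  have pq: "p g * (p g * p h) = p g * p h" for g h
    using assoc_mult_mat[OF pc pc pc, of g g h] by (simp add: pp)
  have pVU: "p g * (V g * U h) = V g * U h" for g h
  proof (cases "g = h")
    case True
    then show ?thesis
      using mult_smult_distrib[OF pc pc] by (simp add: U_def VV pp)
  next
    case False
    then show ?thesis
      using mult_smult_distrib[OF pc mult_carrier_mat[OF pc pc]] by (simp add: U_def VW pq)
  qed
  have pV: "p g * V g = V g" for g
  proof (rule eq_matI)
    fix i l assume "i < dim_row (V g)" "l < dim_col (V g)"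
    then have il: "i < n" "l < m" using V[of g] by auto
    have pVc: "p g * V g \<in> carrier_mat n m" by (rule mult_carrier_mat[OF pc V])
    have "(p g * V g) * (U h * V h * 1\<^sub>m m) = V g * (U h * V h * 1\<^sub>m m)" for h
    proof -
      have "(p g * V g) * (U h * V h) = p g * (V g * U h) * V h"
        using assoc_mult_mat[OF pVc U V] assoc_mult_mat[OF pc V U] by simp
      also have "\<dots> = V g * (U h * V h)" by (simp only: pVU assoc_mult_mat[OF V U V])
      finally show ?thesis using right_mult_one_mat[OF UV] by simp
    qed
    then have "1 * (p g * V g * 1\<^sub>m m) $$ (i, l) = 1 * (V g * 1\<^sub>m m) $$ (i, l)"
      using sums_to_sandwich[OF S pVc one_carrier_mat il]
        sums_to_sandwich[OF S V one_carrier_mat il] by (simp only: Ua)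
    then show "(p g * V g) $$ (i, l) = V g $$ (i, l)"
      by (simp only: right_mult_one_mat[OF pVc] right_mult_one_mat[OF V] mult_1)
  qed (use pc[of g] V[of g] in auto)
  have Up: "U g * p g = U g" for g
    using mat_adjoint_mult[OF pc V, of g g] by (simp add: pV pa Ua)
  \<comment> \<open>The scalar that turns \<open>V\<^sub>g\<^sup>* V\<^sub>g\<close> into a projection.\<close>
  define b where "b g = complex_of_real (\<gamma> / (\<gamma> - a g))" for g
  have b0: "b g \<noteq> 0" and b1: "b g * complex_of_real (1 - a g / \<gamma>) = 1" for g
    using a[of g] g0 by (simp_all add: b_def field_simps flip: of_real_mult)
  define p' where "p' g = b g \<cdot>\<^sub>m (U g * V g)" for g
  have p'c: "p' g \<in> carrier_mat m m" for g using UV by (simp add: p'_def)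
  have p'U: "p' g * U g = U g" for g
  proof -
    have "p' g * U g = b g \<cdot>\<^sub>m (U g * (V g * U g))"
      unfolding p'_def mult_smult_assoc_mat[OF UV U] assoc_mult_mat[OF U V U] ..
    also have "V g * U g = complex_of_real (1 - a g / \<gamma>) \<cdot>\<^sub>m p g" by (simp only: VV U_def)
    also have "b g \<cdot>\<^sub>m (U g * \<dots>) = (b g * complex_of_real (1 - a g / \<gamma>)) \<cdot>\<^sub>m U g"
      by (simp only: mult_smult_distrib[OF U pc] Up smult_smult_mat)
    finally show ?thesis unfolding b1 by simp
  qed
  have p'p': "p' g * p' g = p' g" for g
  proof -
    have "p' g * p' g = p' g * (b g \<cdot>\<^sub>m (U g * V g))" by (simp only: p'_def)
    also have "\<dots> = b g \<cdot>\<^sub>m (p' g * U g * V g)"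
      by (simp only: mult_smult_distrib[OF p'c UV] assoc_mult_mat[OF p'c U V])
    finally show ?thesis by (simp only: p'U) (simp only: p'_def)
  qed
  have p'a: "mat_adjoint (p' g) = p' g" for g
    by (simp add: p'_def mat_adjoint_smult mat_adjoint_mult[OF U V] Ua b_def)
  have fam: "projection_family m p'"
    using p'c p'a p'p' by (simp add: projection_family_def)
  have trace: "mat_trace (p' g) = of_nat (r g)" for g
  proof -
    have "mat_trace (p' g) = b g * mat_trace (V g * U g)"
      unfolding p'_def mat_trace_smult[OF UV] mat_trace_mult_commute[OF U V] ..
    also have "V g * U g = complex_of_real (1 - a g / \<gamma>) \<cdot>\<^sub>m p g" by (simp only: VV U_def)
    also have "mat_trace \<dots> = complex_of_real (1 - a g / \<gamma>) * of_nat (r g)"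
      by (simp only: mat_trace_smult[OF pc] r)
    finally show ?thesis using b1[of g] by (simp only: mult.assoc[symmetric]) simp
  qed
  have sum': "sums_to m (of_real \<gamma>) (\<lambda>g. of_real (\<gamma> - a g) \<cdot>\<^sub>m p' g)"
    unfolding sums_to_def
  proof (intro conjI allI impI)
    fix l l' assume l: "l < m" "l' < m"
    have "(of_real (\<gamma> - a g) \<cdot>\<^sub>m p' g) $$ (l, l') = of_real \<gamma> * (U g * V g) $$ (l, l')" for g
    proof -
      have "complex_of_real (\<gamma> - a g) * b g = of_real \<gamma>"
        using a[of g] by (simp add: b_def flip: of_real_mult)
      then have "of_real (\<gamma> - a g) \<cdot>\<^sub>m p' g = of_real \<gamma> \<cdot>\<^sub>m (U g * V g)"
        by (simp only: p'_def smult_smult_mat)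
      moreover have "l < dim_row (U g * V g)" "l' < dim_col (U g * V g)"
        using U[of g] V[of g] l by simp_all
      ultimately show ?thesis by (simp only: index_smult_mat(1))
    qed
    then have "(\<Sum>g\<in>UNIV. (of_real (\<gamma> - a g) \<cdot>\<^sub>m p' g) $$ (l, l')) =
        of_real \<gamma> * (\<Sum>g\<in>UNIV. (U g * V g) $$ (l, l'))" by (simp only: sum_distrib_left)
    also have "(\<Sum>g\<in>UNIV. (U g * V g) $$ (l, l')) = (if l = l' then 1 else 0)"
      using S l by (simp only: sums_to_def Ua)
    finally show "(\<Sum>g\<in>UNIV. (of_real (\<gamma> - a g) \<cdot>\<^sub>m p' g) $$ (l, l')) = (if l = l' then of_real \<gamma> else 0)"
      by simp
  qed (use p'c in auto)
  have dim: "m = (\<Sum>g\<in>UNIV. r g) - n"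
  proof -
    have "complex_of_real (\<Sum>g\<in>UNIV. a g * r g) = of_real (n * \<gamma>)"
      using sums_to_trace[OF sum] by (simp add: mat_trace_smult[OF pc] r)
    then have 1: "(\<Sum>g\<in>UNIV. a g * r g) = n * \<gamma>" by (simp only: of_real_eq_iff)
    have "complex_of_real (\<Sum>g\<in>UNIV. (\<gamma> - a g) * r g) = of_real (m * \<gamma>)"
      using sums_to_trace[OF sum'] by (simp add: mat_trace_smult[OF p'c] trace)
    then have "(\<Sum>g\<in>UNIV. (\<gamma> - a g) * r g) = m * \<gamma>" by (simp only: of_real_eq_iff)
    then have "\<gamma> * real (\<Sum>g\<in>UNIV. r g) = \<gamma> * (m + n)"
      using 1 by (simp add: algebra_simps sum_subtractf sum_distrib_left)
    then have "real (\<Sum>g\<in>UNIV. r g) = real (m + n)" using g0 by simp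
    then show ?thesis by (simp only: of_nat_eq_iff)
  qed
  have orth: "p' g * p' h = 0\<^sub>m m m" if gh: "g \<noteq> h" and z: "p g * p h = 0\<^sub>m n n" for g h
  proof -
    have "p' g * (U h * V h) = b g \<cdot>\<^sub>m (U g * (V g * U h) * V h)"
      unfolding p'_def mult_smult_assoc_mat[OF UV UV] assoc_mult_mat[OF U V UV]
        assoc_mult_mat[OF V U V, symmetric] assoc_mult_mat[OF U VU V] ..
    also have "V g * U h = 0\<^sub>m n n" using VW[OF gh] z by (simp add: U_def)
    also have "b g \<cdot>\<^sub>m (U g * 0\<^sub>m n n * V h) = 0\<^sub>m m m"
      using U[of g] V[of h] by (simp add: right_mult_zero_mat[OF U] left_mult_zero_mat[OF V])
    finally show ?thesis
      by (simp add: p'_def[of h] mult_smult_distrib[OF p'c UV])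
  qed
  \<comment> \<open>Why pulling back respects invariance: \<open>U g\<close> turns \<open>p h\<close> on the right into \<open>p' g\<close> on the left.\<close>
  have key: "\<exists>s. U g * p h = s \<cdot>\<^sub>m (p' g * U h)" for g h
  proof (cases "g = h")
    case True
    then show ?thesis by (intro exI[of _ 1]) (simp add: Up p'U)
  next
    case False
    define k where "k = complex_of_real (- (sqrt (a g * a h) / \<gamma>))"
    have k: "k \<noteq> 0" using a(1)[of g] a(1)[of h] g0 by (simp add: k_def)
    have "p' g * U h = b g \<cdot>\<^sub>m (U g * (V g * U h))"
      unfolding p'_def mult_smult_assoc_mat[OF UV U] assoc_mult_mat[OF U V U] ..
    also have "V g * U h = k \<cdot>\<^sub>m (p g * p h)" using VW[OF False] by (simp only: U_def k_def)
    also have "U g * \<dots> = k \<cdot>\<^sub>m (U g * p g * p h)"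
      unfolding mult_smult_distrib[OF U mult_carrier_mat[OF pc pc]] assoc_mult_mat[OF U pc pc] ..
    finally have "p' g * U h = (b g * k) \<cdot>\<^sub>m (U g * p h)" by (simp only: Up smult_smult_mat)
    moreover have "inverse (b g * k) * (b g * k) = 1" using k b0[of g] by (intro left_inverse) simp
    ultimately have "U g * p h = inverse (b g * k) \<cdot>\<^sub>m (p' g * U h)"
      by (simp only: smult_smult_mat one_smult_mat)
    then show ?thesis ..
  qed
  have irr': "irreducible_family m p'"
    unfolding irreducible_family_def
  proof (intro conjI allI impI)
    show "0 < m" using dim big by simp
    fix W' assume "vec_subspace m W' \<and> (\<forall>g. \<forall>w\<in>W'. p' g *\<^sub>v w \<in> W')"
    then have W': "vec_subspace m W'" and inv: "\<And>g w. w \<in> W' \<Longrightarrow> p' g *\<^sub>v w \<in> W'" by auto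
    have W'c: "w \<in> carrier_vec m" if "w \<in> W'" for w using W' that by (auto simp: vec_subspace_def)
    have sc: "s \<cdot>\<^sub>v w \<in> W'" if "w \<in> W'" for s w using W' that by (auto simp: vec_subspace_def)
    define W where "W = {w \<in> carrier_vec n. \<forall>g. U g *\<^sub>v w \<in> W'}"
    have Uw: "U g *\<^sub>v (p h *\<^sub>v w) \<in> W'" if w: "w \<in> carrier_vec n" and "U h *\<^sub>v w \<in> W'" for g h w
    proof -
      obtain s where s: "U g * p h = s \<cdot>\<^sub>m (p' g * U h)" using key by blast
      have "U g *\<^sub>v (p h *\<^sub>v w) = s \<cdot>\<^sub>v (p' g *\<^sub>v (U h *\<^sub>v w))"
        unfolding assoc_mult_mat_vec[OF U pc w, symmetric] s assoc_mult_mat_vec[OF p'c U w, symmetric]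
        using mult_carrier_mat[OF p'c U, of g h] w by (intro eq_vecI) auto
      then show ?thesis using that by (simp add: inv sc)
    qed
    have "vec_subspace n W"
      unfolding vec_subspace_def
    proof (intro conjI ballI allI)
      have "U g *\<^sub>v 0\<^sub>v n = 0\<^sub>v m" for g using U[of g] by (intro eq_vecI) auto
      then show "0\<^sub>v n \<in> W" using W' by (auto simp: W_def vec_subspace_def)
      show "x + y \<in> W" if "x \<in> W" "y \<in> W" for x y
        using that W' by (auto simp: W_def vec_subspace_def mult_add_distrib_mat_vec[OF U])
      show "c \<cdot>\<^sub>v x \<in> W" if "x \<in> W" for c x
        using that W' by (auto simp: W_def vec_subspace_def mult_mat_vec[OF U])
    qed (auto simp: W_def)
    moreover have "p h *\<^sub>v w \<in> W" if "w \<in> W" for h w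
      using that Uw mult_mat_vec_carrier[OF pc] by (auto simp: W_def)
    ultimately consider "W = {0\<^sub>v n}" | "W = carrier_vec n"
      using irr unfolding irreducible_family_def by blast
    then show "W' = {0\<^sub>v m} \<or> W' = carrier_vec m"
    proof cases
      case 1
      have "w = 0\<^sub>v m" if w: "w \<in> W'" for w
      proof -
        note wc = W'c[OF w]
        have UVw: "U h *\<^sub>v (V h *\<^sub>v w) \<in> W'" for h
        proof -
          have "U h *\<^sub>v (V h *\<^sub>v w) = inverse (b h) \<cdot>\<^sub>v (p' h *\<^sub>v w)"
            unfolding assoc_mult_mat_vec[OF U V wc, symmetric] p'_def
            using UV[of h h] wc b0[of h] by (intro eq_vecI) auto
          then show ?thesis by (simp add: inv sc w)
        qed
        have z: "V h *\<^sub>v w = 0\<^sub>v n" for h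
        proof -
          have "V h *\<^sub>v w \<in> carrier_vec n" by (rule mult_mat_vec_carrier[OF V wc])
          moreover have "p h *\<^sub>v (V h *\<^sub>v w) = V h *\<^sub>v w"
            using assoc_mult_mat_vec[OF pc[of h] V[of h] wc] by (simp only: pV)
          ultimately have "V h *\<^sub>v w \<in> W"
            using Uw[of "V h *\<^sub>v w" h] UVw by (simp add: W_def)
          then show ?thesis using 1 by simp
        qed
        show ?thesis
        proof (rule eq_vecI)
          fix i assume "i < dim_vec (0\<^sub>v m :: complex vec)"
          then have i: "i < m" by simp
          have "(mat_adjoint (V h) * V h *\<^sub>v w) $ i = 0" for h
            unfolding Ua assoc_mult_mat_vec[OF U V wc] z using U[of h] i by simp
          then show "w $ i = 0\<^sub>v m $ i"
            using sums_to_mult_vec[OF S wc i] i by (simp del: index_mult_mat_vec assoc_mult_mat_vec)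
        qed (use wc in simp)
      qed
      moreover have "0\<^sub>v m \<in> W'" using W' by (simp add: vec_subspace_def)
      ultimately show ?thesis by blast
    next
      case 2
      have "w \<in> W'" if wc: "w \<in> carrier_vec m" for w
      proof -
        have "U h *\<^sub>v (V h *\<^sub>v w) \<in> W'" for h
          using mult_mat_vec_carrier[OF V wc, of h] 2 by (auto simp: W_def)
        then have "vec m (\<lambda>i. \<Sum>h\<in>UNIV. (U h *\<^sub>v (V h *\<^sub>v w)) $ i) \<in> W'"
          by (intro vec_subspace_sum[OF W']) auto
        also have "vec m (\<lambda>i. \<Sum>h\<in>UNIV. (U h *\<^sub>v (V h *\<^sub>v w)) $ i) = w"
          using sums_to_mult_vec[OF S wc] wc
          by (intro eq_vecI) (simp_all add: Ua assoc_mult_mat_vec[OF U V wc] del: index_mult_mat_vec)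
        finally show ?thesis .
      qed
      then show ?thesis using W'c by blast
    qed
  qed
  show thesis by (rule that[OF dim fam irr' sum' trace orth])
qed

section \<open>Bounding a weight by the central value\<close>

definition norm_square :: "complex vec \<Rightarrow> real" where
  "norm_square v = (\<Sum>i<dim_vec v. (cmod (v $ i))\<^sup>2)"

lemma norm_square_nonneg: "0 \<le> norm_square v"
  by (simp add: norm_square_def sum_nonneg)

lemma norm_square_eq_0: "v \<in> carrier_vec n \<Longrightarrow> norm_square v = 0 \<longleftrightarrow> v = 0\<^sub>v n"
  by (auto simp: norm_square_def sum_nonneg_eq_0_iff vec_eq_iff)

lemma projection_quadratic_form:
  fixes P :: "complex mat"
  assumes P: "P \<in> carrier_mat n n" "mat_adjoint P = P" "P * P = P" and v: "v \<in> carrier_vec n"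
  shows "(\<Sum>i<n. (P *\<^sub>v v) $ i * cnj (v $ i)) = of_real (norm_square (P *\<^sub>v v))"
proof -
  define u where "u = P *\<^sub>v v"
  have u: "u \<in> carrier_vec n" unfolding u_def by (rule mult_mat_vec_carrier[OF P(1) v])
  have Pu: "P *\<^sub>v u = u" using assoc_mult_mat_vec[OF P(1) P(1) v] by (simp add: u_def P(3))
  have ent: "cnj (P $$ (i, j)) = P $$ (j, i)" if "i < n" "j < n" for i j
    using index_mat_adjoint[of j P i] P(1,2) that by simp
  have mv: "(P *\<^sub>v w) $ i = (\<Sum>j<n. P $$ (i, j) * w $ j)" if "w \<in> carrier_vec n" "i < n" for w i
    using that P(1) by (simp add: scalar_prod_def atLeast0LessThan)
  have cu: "cnj (u $ j) = (\<Sum>i<n. cnj (P $$ (j, i)) * cnj (v $ i))" if "j < n" for j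
    unfolding u_def mv[OF v that] by simp
  have "(\<Sum>i<n. u $ i * cnj (v $ i)) = (\<Sum>i<n. (P *\<^sub>v u) $ i * cnj (v $ i))" by (simp only: Pu)
  also have "\<dots> = (\<Sum>i<n. \<Sum>j<n. P $$ (i, j) * u $ j * cnj (v $ i))"
    by (intro sum.cong HOL.refl) (simp add: mv[OF u] sum_distrib_right del: index_mult_mat_vec)
  also have "\<dots> = (\<Sum>j<n. \<Sum>i<n. u $ j * (cnj (P $$ (j, i)) * cnj (v $ i)))"
    by (subst sum.swap) (simp add: ent mult_ac)
  also have "\<dots> = (\<Sum>j<n. u $ j * cnj (u $ j))"
    by (intro sum.cong HOL.refl) (simp add: cu sum_distrib_left)
  also have "\<dots> = of_real (norm_square u)"
    using u by (simp add: norm_square_def complex_norm_square del: of_real_power)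
  finally show ?thesis by (simp add: u_def)
qed

text \<open>For \<open>e\<close> in the range of \<open>p h\<close>, pairing the weighted sum with \<open>e\<close> gives
  \<open>\<Sum>g. a g * \<parallel>p g e\<parallel>\<^sup>2 = \<gamma> * \<parallel>e\<parallel>\<^sup>2\<close>, and the term of \<open>h\<close> alone is \<open>a h * \<parallel>e\<parallel>\<^sup>2\<close>. If
  \<open>a h \<ge> \<gamma>\<close>, all other terms vanish, so the line of \<open>e\<close> is invariant.\<close>

lemma irreducible_weight_bound:
  fixes p :: "'g::finite \<Rightarrow> complex mat"
  assumes p: "projection_family n p" and irr: "irreducible_family n p" and n: "2 \<le> n"
    and sum: "sums_to n (of_real \<gamma>) (\<lambda>g. of_real (a g) \<cdot>\<^sub>m p g)"
    and a: "\<And>g. 0 < a g" and h: "p h \<noteq> 0\<^sub>m n n"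
  shows "a h < \<gamma>"
proof (rule ccontr)
  assume "\<not> a h < \<gamma>"
  have pc: "p g \<in> carrier_mat n n" and pa: "mat_adjoint (p g) = p g" and pp: "p g * p g = p g" for g
    using p by (auto simp: projection_family_def)
  obtain i j where ij: "i < n" "j < n" "p h $$ (i, j) \<noteq> 0"
    using h pc[of h] by (metis carrier_matD eq_matI index_zero_mat)
  define e where "e = p h *\<^sub>v unit_vec n j"
  have e: "e \<in> carrier_vec n" unfolding e_def by (rule mult_mat_vec_carrier[OF pc]) simp
  have he: "p h *\<^sub>v e = e"
    using assoc_mult_mat_vec[OF pc[of h] pc[of h], of "unit_vec n j"] by (simp add: e_def pp)
  have e0: "e \<noteq> 0\<^sub>v n"
  proof
    assume "e = 0\<^sub>v n"
    then have "e $ i = 0" using ij by simp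
    then show False using ij pc[of h] by (simp add: e_def scalar_prod_right_unit)
  qed
  have "complex_of_real (\<Sum>g\<in>UNIV. a g * norm_square (p g *\<^sub>v e)) =
      (\<Sum>g\<in>UNIV. \<Sum>i<n. of_real (a g) * ((p g *\<^sub>v e) $ i * cnj (e $ i)))"
    by (simp add: projection_quadratic_form[OF pc pa pp e] flip: sum_distrib_left)
  also have "\<dots> = (\<Sum>i<n. (\<Sum>g\<in>UNIV. ((of_real (a g) \<cdot>\<^sub>m p g) *\<^sub>v e) $ i) * cnj (e $ i))"
  proof -
    have "((of_real (a g) \<cdot>\<^sub>m p g) *\<^sub>v e) $ i = of_real (a g) * (p g *\<^sub>v e) $ i" if "i < n" for i g
      using that pc[of g] e by (simp add: row_smult)
    then show ?thesis by (subst sum.swap) (simp add: sum_distrib_right mult.assoc)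
  qed
  also have "\<dots> = (\<Sum>i<n. of_real \<gamma> * (e $ i * cnj (e $ i)))"
    by (intro sum.cong) (simp_all add: sums_to_mult_vec[OF sum e] mult.assoc del: index_mult_mat_vec)
  also have "\<dots> = of_real (\<gamma> * norm_square e)"
    using e by (simp add: norm_square_def complex_norm_square sum_distrib_left del: of_real_power)
  finally have "(\<Sum>g\<in>UNIV. a g * norm_square (p g *\<^sub>v e)) = \<gamma> * norm_square e"
    by (simp only: of_real_eq_iff)
  moreover have "(\<Sum>g\<in>UNIV. a g * norm_square (p g *\<^sub>v e)) =
      a h * norm_square e + (\<Sum>g\<in>UNIV - {h}. a g * norm_square (p g *\<^sub>v e))"
    by (subst sum.remove[of _ h]) (simp_all add: he)
  moreover have "\<gamma> * norm_square e \<le> a h * norm_square e"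
    using \<open>\<not> a h < \<gamma>\<close> norm_square_nonneg[of e] by (simp add: mult_right_mono)
  ultimately have "(\<Sum>g\<in>UNIV - {h}. a g * norm_square (p g *\<^sub>v e)) \<le> 0" by linarith
  moreover have nn: "0 \<le> a g * norm_square (p g *\<^sub>v e)" for g
    using a[of g] norm_square_nonneg by simp
  ultimately have "(\<Sum>g\<in>UNIV - {h}. a g * norm_square (p g *\<^sub>v e)) = 0"
    by (meson antisym sum_nonneg)
  then have "\<forall>g\<in>UNIV - {h}. a g * norm_square (p g *\<^sub>v e) = 0"
    using nn by (subst (asm) sum_nonneg_eq_0_iff) auto
  then have z: "p g *\<^sub>v e = 0\<^sub>v n" if "g \<noteq> h" for g
  proof -
    have "a g * norm_square (p g *\<^sub>v e) = 0" using bspec[OF \<open>\<forall>g\<in>UNIV - {h}. _\<close>, of g] that by simp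
    then have "norm_square (p g *\<^sub>v e) = 0" using a[of g] by simp
    then show ?thesis using norm_square_eq_0[OF mult_mat_vec_carrier[OF pc e]] by simp
  qed
  define W where "W = {c \<cdot>\<^sub>v e | c. True}"
  have W0: "0\<^sub>v n \<in> W" using e by (auto simp: W_def intro!: exI[of _ 0])
  have "vec_subspace n W"
    unfolding vec_subspace_def
  proof (intro conjI ballI allI)
    show "x + y \<in> W" if xy: "x \<in> W" "y \<in> W" for x y
    proof -
      obtain c d where "x = c \<cdot>\<^sub>v e" "y = d \<cdot>\<^sub>v e" using xy by (auto simp: W_def)
      then have "x + y = (c + d) \<cdot>\<^sub>v e" by (simp add: add_smult_distrib_vec)
      then show ?thesis by (auto simp: W_def)
    qed
    show "c \<cdot>\<^sub>v x \<in> W" if "x \<in> W" for c x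
      using that by (auto simp: W_def smult_smult_assoc)
  qed (use e W0 in \<open>auto simp: W_def\<close>)
  moreover have "p g *\<^sub>v w \<in> W" if wW: "w \<in> W" for g w
  proof -
    obtain c where w: "w = c \<cdot>\<^sub>v e" using wW by (auto simp: W_def)
    have "p g *\<^sub>v w = c \<cdot>\<^sub>v (p g *\<^sub>v e)" unfolding w by (rule mult_mat_vec[OF pc e])
    also have "\<dots> \<in> W"
    proof (cases "g = h")
      case True
      then show ?thesis by (auto simp: he W_def)
    next
      case False
      then have "c \<cdot>\<^sub>v (p g *\<^sub>v e) = 0\<^sub>v n" by (intro eq_vecI) (simp_all add: z)
      then show ?thesis using W0 by simp
    qed
    finally show ?thesis .
  qed
  ultimately have "W = {0\<^sub>v n} \<or> W = carrier_vec n"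
    using irr unfolding irreducible_family_def by blast
  moreover have "e \<in> W" by (auto simp: W_def intro!: exI[of _ 1])
  ultimately have W: "W = carrier_vec n" using e0 by auto
  obtain i where i: "i < n" "e $ i \<noteq> 0" using e0 e by (auto simp: vec_eq_iff)
  define j :: nat where "j = (if i = 0 then 1 else 0)"
  have j: "j < n" "j \<noteq> i" using n by (auto simp: j_def)
  have "unit_vec n j \<in> W" by (simp add: W)
  then obtain c where c: "unit_vec n j = c \<cdot>\<^sub>v e" by (auto simp: W_def)
  have "c * e $ i = unit_vec n j $ i" unfolding c using i e by simp
  then have "c = 0" using i j by simp
  moreover have "c * e $ j = unit_vec n j $ j" unfolding c using j e by simp
  ultimately show False using j by simp
qed

text \<open>The trace of a projection is the sum of the squared moduli of its entries.\<close>

lemma trace_zero_projection: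
  fixes P :: "complex mat"
  assumes P: "P \<in> carrier_mat n n" "mat_adjoint P = P" "P * P = P" and t: "mat_trace P = 0"
  shows "P = 0\<^sub>m n n"
proof -
  have "P $$ (i, i) = of_real (\<Sum>j<n. (cmod (P $$ (i, j)))\<^sup>2)" if i: "i < n" for i
  proof -
    have "P $$ (i, i) = (P * mat_adjoint P) $$ (i, i)" using P by simp
    also have "\<dots> = (\<Sum>j<n. P $$ (i, j) * cnj (P $$ (i, j)))"
      by (subst index_mult_mat_sum[OF P(1) mat_adjoint_carrier[OF P(1)] i i]) (use P(1) i in auto)
    finally show ?thesis by (simp add: complex_norm_square del: of_real_power)
  qed
  then have "complex_of_real (\<Sum>i<n. \<Sum>j<n. (cmod (P $$ (i, j)))\<^sup>2) = 0"
    using t P(1) by (simp add: mat_trace_def)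
  then have "(\<Sum>i<n. \<Sum>j<n. (cmod (P $$ (i, j)))\<^sup>2) = 0" by (simp only: of_real_eq_0_iff)
  then have "\<forall>i<n. \<forall>j<n. P $$ (i, j) = 0"
    by (simp add: sum_nonneg_eq_0_iff sum_nonneg)
  then show ?thesis using P(1) by (intro eq_matI) auto
qed

section \<open>Projection systems on the extended Dynkin graph\<close>

lemma UNIV_e6_gen: "UNIV = {P1, P2, Q1, Q2, S1, S2}"
  using e6_gen.exhaust by auto

instance e6_gen :: finite
  by standard (simp add: UNIV_e6_gen)

lemma sum_e6_gen:
  "(\<Sum>g\<in>UNIV. f g) = f P1 + f P2 + f Q1 + f Q2 + f S1 + (f S2 :: 'a::comm_monoid_add)"
  by (simp add: UNIV_e6_gen add.assoc)

fun branch_partner :: "e6_gen \<Rightarrow> e6_gen" where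
  "branch_partner P1 = P2"
| "branch_partner P2 = P1"
| "branch_partner Q1 = Q2"
| "branch_partner Q2 = Q1"
| "branch_partner S1 = S2"
| "branch_partner S2 = S1"

fun is_leading :: "e6_gen \<Rightarrow> bool" where
  "is_leading P1 = True"
| "is_leading P2 = False"
| "is_leading Q1 = True"
| "is_leading Q2 = False"
| "is_leading S1 = True"
| "is_leading S2 = False"

lemma branch_partner_branch_partner [simp]: "branch_partner (branch_partner g) = g"
  by (cases g) auto

lemma branch_partner_neq [simp]: "branch_partner g \<noteq> g" "g \<noteq> branch_partner g"
  by (cases g; simp)+

lemma is_leading_branch_partner [simp]: "is_leading (branch_partner g) \<longleftrightarrow> \<not> is_leading g"
  by (cases g) auto

lemma sum_branch_partner: "(\<Sum>g\<in>UNIV. f (branch_partner g)) = (\<Sum>g\<in>UNIV. f g)"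
  by (rule sum.reindex_bij_witness[of _ branch_partner branch_partner]) auto

definition e6_system ::
    "nat \<Rightarrow> (e6_gen \<Rightarrow> real) \<Rightarrow> real \<Rightarrow> (e6_gen \<Rightarrow> nat) \<Rightarrow> (e6_gen \<Rightarrow> complex mat) \<Rightarrow> bool" where
  "e6_system n a \<gamma> r p \<longleftrightarrow> projection_family n p \<and> irreducible_family n p \<and>
     sums_to n (of_real \<gamma>) (\<lambda>g. of_real (a g) \<cdot>\<^sub>m p g) \<and>
     (\<forall>g. mat_trace (p g) = of_nat (r g)) \<and>
     (\<forall>g. p g * p (branch_partner g) = 0\<^sub>m n n)"

lemma irreducible_family_reindex:
  assumes "irreducible_family n p" and "\<And>g. s (s g) = g"
  shows "irreducible_family n (\<lambda>g. p (s g))"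
  using assms unfolding irreducible_family_def by metis

lemma e6_system_trace:
  assumes "e6_system n a \<gamma> r p"
  shows "(\<Sum>g\<in>UNIV. a g * r g) = n * \<gamma>"
proof -
  have pc: "p g \<in> carrier_mat n n" and r: "mat_trace (p g) = of_nat (r g)" for g
    using assms by (auto simp: e6_system_def projection_family_def)
  have "complex_of_real (\<Sum>g\<in>UNIV. a g * r g) = of_real (n * \<gamma>)"
    using sums_to_trace[of n "of_real \<gamma>" "\<lambda>g. of_real (a g) \<cdot>\<^sub>m p g"] assms
    by (simp add: mat_trace_smult[OF pc] r e6_system_def)
  then show ?thesis by (simp only: of_real_eq_iff)
qed

lemma e6_system_weight_bound:
  assumes "e6_system n a \<gamma> r p" "2 \<le> n" "\<And>g. 0 < a g" "0 < r h"
  shows "a h < \<gamma>"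
proof (rule irreducible_weight_bound)
  show "p h \<noteq> 0\<^sub>m n n"
  proof
    assume "p h = 0\<^sub>m n n"
    then have "mat_trace (p h) = 0" by (simp add: mat_trace_def)
    with assms show False by (simp add: e6_system_def)
  qed
qed (use assms in \<open>auto simp: e6_system_def\<close>)

text \<open>The larger weight of a branch becomes the smaller one under \<open>a g \<mapsto> \<gamma> - a g\<close>; exchanging the two
  projections of each branch restores the order.\<close>

lemma e6_system_reflect_even:
  assumes sys: "e6_system n a \<gamma> r p" and a: "\<And>g. 0 < a g" "\<And>g. a g < \<gamma>"
    and big: "n < (\<Sum>g\<in>UNIV. r g)"
  obtains p' where "e6_system ((\<Sum>g\<in>UNIV. r g) - n) (\<lambda>g. \<gamma> - a (branch_partner g)) \<gamma>
    (\<lambda>g. r (branch_partner g)) p'"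
proof -
  have p: "projection_family n p" and irr: "irreducible_family n p"
    and sum: "sums_to n (of_real \<gamma>) (\<lambda>g. of_real (a g) \<cdot>\<^sub>m p g)"
    and r: "mat_trace (p g) = of_nat (r g)" and o: "p g * p (branch_partner g) = 0\<^sub>m n n" for g
    using sys by (auto simp: e6_system_def)
  obtain m p' where m: "m = (\<Sum>g\<in>UNIV. r g) - n"
    and p': "projection_family m p'" and irr': "irreducible_family m p'"
    and sum': "sums_to m (of_real \<gamma>) (\<lambda>g. of_real (\<gamma> - a g) \<cdot>\<^sub>m p' g)"
    and r': "\<And>g. mat_trace (p' g) = of_nat (r g)"
    and o': "\<And>g h. g \<noteq> h \<Longrightarrow> p g * p h = 0\<^sub>m n n \<Longrightarrow> p' g * p' h = 0\<^sub>m m m"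
    by (rule hyperbolic_reflection[OF p irr sum a r big]) (rule that)
  have "e6_system m (\<lambda>g. \<gamma> - a (branch_partner g)) \<gamma> (\<lambda>g. r (branch_partner g))
      (\<lambda>g. p' (branch_partner g))"
    unfolding e6_system_def
  proof (intro conjI allI)
    show "projection_family m (\<lambda>g. p' (branch_partner g))"
      using p' by (simp add: projection_family_def)
    show "irreducible_family m (\<lambda>g. p' (branch_partner g))"
      by (rule irreducible_family_reindex[OF irr']) simp
    show "sums_to m (of_real \<gamma>) (\<lambda>g. of_real (\<gamma> - a (branch_partner g)) \<cdot>\<^sub>m p' (branch_partner g))"
      using sum' unfolding sums_to_def
      by (simp add: sum_branch_partner[of "\<lambda>g. (of_real (\<gamma> - a g) \<cdot>\<^sub>m p' g) $$ _"] del: of_real_diff)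
    show "mat_trace (p' (branch_partner g)) = of_nat (r (branch_partner g))" for g by (rule r')
    show "p' (branch_partner g) * p' (branch_partner (branch_partner g)) = 0\<^sub>m m m" for g
      by (rule o'[OF _ o]) simp
  qed
  then show thesis using m that by simp
qed

lemma vec_subspace_minus:
  assumes "vec_subspace n W" "x \<in> W" "y \<in> W"
  shows "x - y \<in> W"
proof -
  have "x \<in> carrier_vec n" "y \<in> carrier_vec n" using assms by (auto simp: vec_subspace_def)
  then have "x - y = x + (- 1) \<cdot>\<^sub>v y" by (intro eq_vecI) auto
  then show ?thesis using assms by (simp add: vec_subspace_def)
qed

text \<open>The complement \<open>1 - p\<^sub>1 - p\<^sub>2\<close> takes over the largest eigenvalue of \<open>\<alpha>\<^sub>1 - A\<close>, and \<open>p\<^sub>2\<close> the eigenvalue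
  \<open>\<alpha>\<^sub>1 - \<alpha>\<^sub>2\<close>.\<close>

lemma e6_system_reflect_odd:
  assumes sys: "e6_system n a \<gamma> r p" and big: "\<And>g. r g + r (branch_partner g) \<le> n"
  obtains p' where "e6_system n (\<lambda>g. if is_leading g then a g else a (branch_partner g) - a g)
    (a P1 + a Q1 + a S1 - \<gamma>)
    (\<lambda>g. if is_leading g then n - r g - r (branch_partner g) else r g) p'"
proof -
  have irr: "irreducible_family n p"
    and sum: "sums_to n (of_real \<gamma>) (\<lambda>g. of_real (a g) \<cdot>\<^sub>m p g)"
    and r: "mat_trace (p g) = of_nat (r g)" and o: "p g * p (branch_partner g) = 0\<^sub>m n n"
    and pc: "p g \<in> carrier_mat n n" and pa: "mat_adjoint (p g) = p g" and pp: "p g * p g = p g" for g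
    using sys by (auto simp: e6_system_def projection_family_def)
  have pd [simp]: "dim_row (p g) = n" "dim_col (p g) = n" for g using pc[of g] by auto
  have o': "p (branch_partner g) * p g = 0\<^sub>m n n" for g using o[of "branch_partner g"] by simp
  define e where "e g = p g + p (branch_partner g)" for g
  have ec: "e g \<in> carrier_mat n n" for g using pc by (simp add: e_def)
  have ee: "e g * e g = e g" for g
    using pc by (simp add: e_def add_mult_distrib_mat[of _ n n _ _ n]
      mult_add_distrib_mat[of _ n n _ n] o o' pp)
  have ep: "e g * p (branch_partner g) = p (branch_partner g)" for g
    using pc by (simp add: e_def add_mult_distrib_mat[of _ n n _ _ n] o pp)
  have pe: "p g * e (branch_partner g) = p g" for g
    using pc by (simp add: e_def mult_add_distrib_mat[of _ n n _ n] o pp)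
  have aij: "cnj (p g $$ (j, i)) = p g $$ (i, j)" if "i < n" "j < n" for g i j
    using index_mat_adjoint[of i "p g" j] that by (simp add: pa)
  define p' where "p' g = (if is_leading g then 1\<^sub>m n - e g else p g)" for g
  have p'c: "p' g \<in> carrier_mat n n" for g by (simp add: p'_def pc minus_carrier_mat[OF ec])
  have "e6_system n (\<lambda>g. if is_leading g then a g else a (branch_partner g) - a g)
    (a P1 + a Q1 + a S1 - \<gamma>)
    (\<lambda>g. if is_leading g then n - r g - r (branch_partner g) else r g) p'"
    unfolding e6_system_def
  proof (intro conjI allI)
    show "projection_family n p'"
      unfolding projection_family_def
    proof (intro conjI allI)
      fix g
      show "p' g \<in> carrier_mat n n" by (rule p'c)
      show "mat_adjoint (p' g) = p' g"
        using p'c[of g] by (intro eq_matI) (auto simp: p'_def e_def aij pa)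
      show "p' g * p' g = p' g"
      proof (cases "is_leading g")
        case True
        have k: "1\<^sub>m n - e g \<in> carrier_mat n n" by (rule minus_carrier_mat[OF ec])
        have "(1\<^sub>m n - e g) * (1\<^sub>m n - e g) =
            (1\<^sub>m n - e g) * 1\<^sub>m n - (1\<^sub>m n * e g - e g * e g)"
          by (simp only: mult_minus_distrib_mat[OF k one_carrier_mat ec]
            minus_mult_distrib_mat[OF one_carrier_mat ec ec])
        also have "\<dots> = 1\<^sub>m n - e g"
          unfolding right_mult_one_mat[OF k] left_mult_one_mat[OF ec] ee
          using ec[of g] by (intro eq_matI) auto
        finally show ?thesis using True by (simp add: p'_def)
      qed (simp add: p'_def pp)
    qed
    show "mat_trace (p' g) =
        of_nat (if is_leading g then n - r g - r (branch_partner g) else r g)" for g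
    proof (cases "is_leading g")
      case True
      have "mat_trace (p' g) = of_nat n - (mat_trace (p g) + mat_trace (p (branch_partner g)))"
        using True by (simp add: p'_def e_def mat_trace_def sum_subtractf sum.distrib)
      then show ?thesis using big[of g] True by (simp add: r of_nat_diff)
    qed (simp add: p'_def r)
    show "p' g * p' (branch_partner g) = 0\<^sub>m n n" for g
    proof (cases "is_leading g")
      case True
      have "(1\<^sub>m n - e g) * p (branch_partner g) = 0\<^sub>m n n"
        unfolding minus_mult_distrib_mat[OF one_carrier_mat ec pc] ep left_mult_one_mat[OF pc]
        by (rule minus_r_inv_mat[OF pc])
      with True show ?thesis by (simp add: p'_def)
    next
      case False
      have "p g * (1\<^sub>m n - e (branch_partner g)) = 0\<^sub>m n n"
        unfolding mult_minus_distrib_mat[OF pc one_carrier_mat ec] pe right_mult_one_mat[OF pc]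
        by (rule minus_r_inv_mat[OF pc])
      with False show ?thesis by (simp add: p'_def)
    qed
    show "irreducible_family n p'"
      unfolding irreducible_family_def
    proof (intro conjI allI impI)
      show "0 < n" using irr by (simp add: irreducible_family_def)
      fix W assume "vec_subspace n W \<and> (\<forall>g. \<forall>w\<in>W. p' g *\<^sub>v w \<in> W)"
      then have W: "vec_subspace n W" and inv: "\<And>g w. w \<in> W \<Longrightarrow> p' g *\<^sub>v w \<in> W" by auto
      have "p g *\<^sub>v w \<in> W" if w: "w \<in> W" for g w
      proof (cases "is_leading g")
        case True
        have wc: "w \<in> carrier_vec n" using W w by (auto simp: vec_subspace_def)
        have "p' g *\<^sub>v w = w - (p g *\<^sub>v w + p (branch_partner g) *\<^sub>v w)"
          using True wc pc by (simp add: p'_def e_def minus_mult_distrib_mat_vec[of _ n n]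
            add_mult_distrib_mat_vec[of _ n n])
        then have "p g *\<^sub>v w = w - p' g *\<^sub>v w - p' (branch_partner g) *\<^sub>v w"
          using True wc by (intro eq_vecI) (auto simp: p'_def[of "branch_partner g"] simp del: index_mult_mat_vec)
        then show ?thesis by (simp only: vec_subspace_minus[OF W] inv w)
      next
        case False
        then show ?thesis using inv[OF w, of g] by (simp add: p'_def)
      qed
      then show "W = {0\<^sub>v n} \<or> W = carrier_vec n"
        using irr W by (auto simp: irreducible_family_def)
    qed
    show "sums_to n (of_real (a P1 + a Q1 + a S1 - \<gamma>))
      (\<lambda>g. of_real (if is_leading g then a g else a (branch_partner g) - a g) \<cdot>\<^sub>m p' g)"
      unfolding sums_to_def
    proof (intro conjI allI impI)
      fix i j assume ij: "i < n" "j < n"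
      have "(\<Sum>g\<in>UNIV. (of_real (a g) \<cdot>\<^sub>m p g) $$ (i, j)) = (if i = j then of_real \<gamma> else 0)"
        using sum ij by (simp add: sums_to_def)
      then show "(\<Sum>g\<in>UNIV. (of_real (if is_leading g then a g else a (branch_partner g) - a g)
          \<cdot>\<^sub>m p' g) $$ (i, j)) = (if i = j then of_real (a P1 + a Q1 + a S1 - \<gamma>) else 0)"
        using ij by (simp add: sum_e6_gen p'_def e_def algebra_simps split: if_splits)
    qed (use p'c in simp)
  qed
  then show thesis by (rule that)
qed

text \<open>The even reflection of a one-dimensional system fixes the weights of the projections that vanish
  as well; this lemma replaces them by the prescribed ones.\<close>

lemma e6_system_change_vacuous_weight:
  assumes sys: "e6_system n a \<gamma> r p" and b: "\<And>g. 0 < r g \<Longrightarrow> b g = a g"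
  shows "e6_system n b \<gamma> r p"
proof -
  have z: "p g = 0\<^sub>m n n" if "r g = 0" for g
    using sys that by (intro trace_zero_projection) (auto simp: e6_system_def projection_family_def)
  have "of_real (b g) \<cdot>\<^sub>m p g = of_real (a g) \<cdot>\<^sub>m p g" for g
    using z[of g] b[of g] by (cases "r g = 0") auto
  then show ?thesis using sys by (simp add: e6_system_def)
qed

lemma e6_system_one_dimensional:
  assumes "a P1 + a Q1 + a S1 = \<gamma>"
  shows "e6_system 1 a \<gamma> (\<lambda>g. if is_leading g then 1 else 0)
    (\<lambda>g. if is_leading g then 1\<^sub>m 1 else 0\<^sub>m 1 1)"
  unfolding e6_system_def
proof (intro conjI allI)
  let ?p = "\<lambda>g. if is_leading g then 1\<^sub>m 1 else 0\<^sub>m 1 1 :: complex mat"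
  show "projection_family 1 ?p"
    by (auto simp: projection_family_def intro!: eq_matI)
  show "irreducible_family 1 ?p"
    unfolding irreducible_family_def
  proof (intro conjI allI impI)
    fix W :: "complex vec set" assume "vec_subspace 1 W \<and> (\<forall>g. \<forall>w\<in>W. ?p g *\<^sub>v w \<in> W)"
    then have W: "vec_subspace 1 W" by blast
    show "W = {0\<^sub>v 1} \<or> W = carrier_vec 1"
    proof (rule disjCI)
      assume "W \<noteq> carrier_vec 1"
      have "w = 0\<^sub>v 1" if w: "w \<in> W" for w
      proof (rule ccontr)
        assume "w \<noteq> 0\<^sub>v 1"
        have wc: "w \<in> carrier_vec 1" using W w by (auto simp: vec_subspace_def)
        then have w0: "w $ 0 \<noteq> 0" using \<open>w \<noteq> 0\<^sub>v 1\<close> by (auto simp: vec_eq_iff)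
        have "x \<in> W" if x: "x \<in> carrier_vec 1" for x
        proof -
          have "x = (x $ 0 / w $ 0) \<cdot>\<^sub>v w" using x wc w0 by (intro eq_vecI) auto
          moreover have "(x $ 0 / w $ 0) \<cdot>\<^sub>v w \<in> W" using W w by (simp add: vec_subspace_def)
          ultimately show ?thesis by simp
        qed
        then show False using \<open>W \<noteq> carrier_vec 1\<close> W by (auto simp: vec_subspace_def)
      qed
      then show "W = {0\<^sub>v 1}" using W by (auto simp: vec_subspace_def)
    qed
  qed simp
  show "sums_to 1 (of_real \<gamma>) (\<lambda>g. of_real (a g) \<cdot>\<^sub>m ?p g)"
    using assms by (simp add: sums_to_def sum_e6_gen flip: of_real_add)
  show "mat_trace (?p g) = of_nat (if is_leading g then 1 else 0)" for g
    by (simp add: mat_trace_def)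
  show "?p g * ?p (branch_partner g) = 0\<^sub>m 1 1" for g by simp
qed

section \<open>Levels, Coxeter reflections and the numerical criterion\<close>

text \<open>The weights \<open>\<chi>\<close> recovered from the vertex coordinates \<open>M_f \<chi>\<close>, in which the reflections are
  expressed.\<close>

fun edge_weight :: "real vec \<Rightarrow> e6_gen \<Rightarrow> real" where
  "edge_weight y P1 = y $ 1"
| "edge_weight y P2 = y $ 1 - y $ 0"
| "edge_weight y Q1 = y $ 3"
| "edge_weight y Q2 = y $ 3 - y $ 2"
| "edge_weight y S1 = y $ 5"
| "edge_weight y S2 = y $ 5 - y $ 4"

lemma c_bullet_index:
  "c_bullet y $ 0 = y $ 1 - y $ 0" "c_bullet y $ 1 = y $ 1"
  "c_bullet y $ 2 = y $ 3 - y $ 2" "c_bullet y $ 3 = y $ 3"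
  "c_bullet y $ 4 = y $ 5 - y $ 4" "c_bullet y $ 5 = y $ 5"
  "c_bullet y $ 6 = y $ 1 + y $ 3 + y $ 5 - y $ 6" "c_bullet y $ Suc 0 = y $ 1"
  by (simp_all add: c_bullet_def vec_of_list_index del: vec_of_list_Cons)

lemma c_circ_index:
  "c_circ y $ 0 = y $ 0" "c_circ y $ 1 = y $ 6 + y $ 0 - y $ 1"
  "c_circ y $ 2 = y $ 2" "c_circ y $ 3 = y $ 6 + y $ 2 - y $ 3"
  "c_circ y $ 4 = y $ 4" "c_circ y $ 5 = y $ 6 + y $ 4 - y $ 5"
  "c_circ y $ 6 = y $ 6" "c_circ y $ Suc 0 = y $ 6 + y $ 0 - y $ 1"
  by (simp_all add: c_circ_def vec_of_list_index del: vec_of_list_Cons)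

lemma dim_reflections: "dim_vec (c_bullet y) = 7" "dim_vec (c_circ y) = 7" "dim_vec (M_f y) = 7"
  by (simp_all add: c_bullet_def c_circ_def M_f_def)

lemma edge_weight_c_bullet:
  "edge_weight (c_bullet y) = (\<lambda>g. if is_leading g then edge_weight y g
     else edge_weight y (branch_partner g) - edge_weight y g)"
  by (rule ext, rename_tac g, case_tac g) (simp_all add: c_bullet_index)

lemma edge_weight_c_circ:
  "edge_weight (c_circ y) = (\<lambda>g. y $ 6 - edge_weight y (branch_partner g))"
  by (rule ext, rename_tac g, case_tac g) (simp_all add: c_circ_index)

text \<open>Together with \<open>level_dim\<close>, the coordinates of \<open>M_d d\<^sub>k\<close> (\<open>M_d_d_vec\<close>).\<close>

definition level_rank :: "nat \<Rightarrow> e6_gen \<Rightarrow> nat" where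
  "level_rank k g =
     (if is_leading g then (k - 1) div 4 + (if even k then 1 else 0) else (k + 1) div 4)"

definition level_dim :: "nat \<Rightarrow> nat" where
  "level_dim k = 2 * ((k - 1) div 4) + 1 + (k + 1) div 4"

definition positive_weight :: "real vec \<Rightarrow> bool" where
  "positive_weight y \<longleftrightarrow> (\<forall>g. 0 < edge_weight y g) \<and>
     (\<forall>g. is_leading g \<longrightarrow> edge_weight y (branch_partner g) < edge_weight y g)"

text \<open>Positivity of the weights is part of the notion so that it can be carried through the reflections
  together with the existence of the system.\<close>

definition realizable :: "nat \<Rightarrow> real vec \<Rightarrow> bool" where
  "realizable k y \<longleftrightarrow> positive_weight y \<and>
     (\<exists>p. e6_system (level_dim k) (edge_weight y) (y $ 6) (level_rank k) p)"

lemma positive_nat_mod_4_cases: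
  fixes k :: nat
  assumes "1 \<le> k"
  obtains q where "k = 4 * q + 1" | q where "k = 4 * q + 2" | q where "k = 4 * q + 3"
    | q where "k = 4 * q + 4"
proof -
  let ?q = "(k - 1) div 4"
  have "k = 4 * ?q + 1 \<or> k = 4 * ?q + 2 \<or> k = 4 * ?q + 3 \<or> k = 4 * ?q + 4"
    using assms by presburger
  then show thesis using that by blast
qed

lemma div_4_simps:
  "Suc (4 * q) div 4 = q" "Suc (Suc (4 * q)) div 4 = q" "(4 * q - Suc 0) div 4 = q - 1"
  by presburger+

lemma level_rank_odd_reflection:
  assumes "1 \<le> k"
  shows "level_rank k g + level_rank k (branch_partner g) \<le> level_dim k"
    and "level_dim (if even k then k - 1 else k + 1) = level_dim k"
    and "level_rank (if even k then k - 1 else k + 1) =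
      (\<lambda>g. if is_leading g then level_dim k - level_rank k g - level_rank k (branch_partner g)
        else level_rank k g)"
  using assms by (atomize (full), cases rule: positive_nat_mod_4_cases[OF assms])
    (auto simp: level_rank_def level_dim_def fun_eq_iff div_4_simps)

lemma level_rank_even_reflection:
  assumes "2 \<le> k"
  shows "level_dim k < (\<Sum>g\<in>UNIV. level_rank k g)"
    and "level_dim (if even k then k + 1 else k - 1) = (\<Sum>g\<in>UNIV. level_rank k g) - level_dim k"
    and "level_rank (if even k then k + 1 else k - 1) = (\<lambda>g. level_rank k (branch_partner g))"
proof -
  have k: "1 \<le> k" using assms by simp
  show "level_dim k < (\<Sum>g\<in>UNIV. level_rank k g)"
    and "level_dim (if even k then k + 1 else k - 1) = (\<Sum>g\<in>UNIV. level_rank k g) - level_dim k"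
    and "level_rank (if even k then k + 1 else k - 1) = (\<lambda>g. level_rank k (branch_partner g))"
    using assms by (atomize (full), cases rule: positive_nat_mod_4_cases[OF k])
      (auto simp: level_rank_def level_dim_def sum_e6_gen fun_eq_iff div_4_simps)
qed

lemma positive_weight_c_bullet:
  assumes y: "positive_weight y"
  shows "positive_weight (c_bullet y)"
proof -
  have pos: "0 < edge_weight y g" for g using y by (simp add: positive_weight_def)
  have less: "edge_weight y (branch_partner g) < edge_weight y g" if "is_leading g" for g
    using y that by (simp add: positive_weight_def)
  have "edge_weight y g < edge_weight y (branch_partner g)" if "\<not> is_leading g" for g
    using less[of "branch_partner g"] that by simp
  then show ?thesis using pos by (auto simp: positive_weight_def edge_weight_c_bullet)
qed

lemma realizable_c_bullet:
  assumes k: "1 \<le> k" and y: "realizable k y"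
  shows "realizable (if even k then k - 1 else k + 1) (c_bullet y)"
proof -
  obtain p where p: "e6_system (level_dim k) (edge_weight y) (y $ 6) (level_rank k) p"
    using y by (auto simp: realizable_def)
  obtain p' where "e6_system (level_dim k) (edge_weight (c_bullet y)) (c_bullet y $ 6)
      (level_rank (if even k then k - 1 else k + 1)) p'"
    using e6_system_reflect_odd[OF p level_rank_odd_reflection(1)[OF k]]
    unfolding edge_weight_c_bullet level_rank_odd_reflection(3)[OF k]
    by (auto simp: c_bullet_index)
  then show ?thesis
    using y unfolding realizable_def level_rank_odd_reflection(2)[OF k]
    by (blast intro: positive_weight_c_bullet)
qed

lemma realizable_c_circ:
  assumes k: "2 \<le> k" and y: "realizable k y" and b: "\<And>g. edge_weight y g < y $ 6"
  shows "realizable (if even k then k + 1 else k - 1) (c_circ y)"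
proof -
  obtain p where p: "e6_system (level_dim k) (edge_weight y) (y $ 6) (level_rank k) p"
    and pos: "positive_weight y"
    using y by (auto simp: realizable_def)
  have a: "0 < edge_weight y g" for g using pos by (simp add: positive_weight_def)
  obtain p' where "e6_system ((\<Sum>g\<in>UNIV. level_rank k g) - level_dim k)
      (edge_weight (c_circ y)) (c_circ y $ 6)
      (level_rank (if even k then k + 1 else k - 1)) p'"
    using e6_system_reflect_even[OF p a b level_rank_even_reflection(1)[OF k]]
    unfolding edge_weight_c_circ level_rank_even_reflection(3)[OF k]
    by (auto simp: c_circ_index)
  moreover have "positive_weight (c_circ y)"
    using pos b unfolding positive_weight_def edge_weight_c_circ by simp
  ultimately show ?thesis
    unfolding realizable_def level_rank_even_reflection(2)[OF k] by blast
qed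

lemma realizable_weight_bound:
  assumes k: "4 \<le> k" and y: "realizable k y"
  shows "edge_weight y g < y $ 6"
proof -
  obtain p where p: "e6_system (level_dim k) (edge_weight y) (y $ 6) (level_rank k) p"
    using y by (auto simp: realizable_def)
  show ?thesis
  proof (rule e6_system_weight_bound[OF p])
    have "0 < (k - 1) div 4 \<or> even k" "0 < (k + 1) div 4" using k by presburger+
    then show "2 \<le> level_dim k" "0 < level_rank k g"
      by (auto simp: level_dim_def level_rank_def)
    show "0 < edge_weight y g" for g using y by (simp add: realizable_def positive_weight_def)
  qed
qed

lemma realizable_cong:
  "edge_weight y = edge_weight z \<Longrightarrow> y $ 6 = z $ 6 \<Longrightarrow> realizable k y \<longleftrightarrow> realizable k z"
  by (simp add: realizable_def positive_weight_def)

lemma realizable_c_bullet_c_bullet: "realizable k (c_bullet (c_bullet y)) \<longleftrightarrow> realizable k y"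
  by (rule realizable_cong) (simp_all add: edge_weight_c_bullet c_bullet_index fun_eq_iff)

lemma realizable_c_circ_c_circ: "realizable k (c_circ (c_circ y)) \<longleftrightarrow> realizable k y"
  by (rule realizable_cong) (simp_all add: edge_weight_c_circ c_circ_index fun_eq_iff)

text \<open>Each reflection is applied once downwards and once upwards; on the weights the two applications
  cancel.\<close>

lemma realizable_step:
  assumes k: "4 \<le> k"
  shows "realizable (Suc k) y \<longleftrightarrow> realizable k (if even (Suc k) then c_bullet y else c_circ y)"
proof (cases "even k")
  case True
  have "realizable k (c_circ y)" if "realizable (Suc k) y"
    using realizable_c_circ[of "Suc k" y] realizable_weight_bound[of "Suc k" y] that k True by simp
  moreover have "realizable (Suc k) (c_circ (c_circ y))" if "realizable k (c_circ y)"
    using realizable_c_circ[of k "c_circ y"] realizable_weight_bound[of k "c_circ y"] that k True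
    by simp
  ultimately show ?thesis using True by (auto simp: realizable_c_circ_c_circ)
next
  case False
  have "realizable k (c_bullet y)" if "realizable (Suc k) y"
    using realizable_c_bullet[of "Suc k" y] that False by simp
  moreover have "realizable (Suc k) (c_bullet (c_bullet y))" if "realizable k (c_bullet y)"
    using realizable_c_bullet[of k "c_bullet y"] that k False by simp
  ultimately show ?thesis using False by (auto simp: realizable_c_bullet_c_bullet)
qed

lemma D_3_mult_vec:
  assumes "dim_vec y = 7"
  shows "(D_3 *\<^sub>v y) $ 0 = y $ 1 - y $ 0"
    and "(D_3 *\<^sub>v y) $ 1 = y $ 1 + y $ 3 + y $ 5 - y $ 6 - y $ 0"
    and "(D_3 *\<^sub>v y) $ 2 = y $ 3 - y $ 2"
    and "(D_3 *\<^sub>v y) $ 3 = y $ 1 + y $ 3 + y $ 5 - y $ 6 - y $ 2"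
    and "(D_3 *\<^sub>v y) $ 4 = y $ 5 - y $ 4"
    and "(D_3 *\<^sub>v y) $ 5 = y $ 1 + y $ 3 + y $ 5 - y $ 6 - y $ 4"
    and "(D_3 *\<^sub>v y) $ 6 = 2 * (y $ 1 + y $ 3 + y $ 5 - y $ 6) - y $ 0 - y $ 2 - y $ 4"
proof -
  have "{0..<7} = {0, 1, 2, 3, 4, 5, 6::nat}" by auto
  then show "(D_3 *\<^sub>v y) $ 0 = y $ 1 - y $ 0"
    and "(D_3 *\<^sub>v y) $ 1 = y $ 1 + y $ 3 + y $ 5 - y $ 6 - y $ 0"
    and "(D_3 *\<^sub>v y) $ 2 = y $ 3 - y $ 2"
    and "(D_3 *\<^sub>v y) $ 3 = y $ 1 + y $ 3 + y $ 5 - y $ 6 - y $ 2"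
    and "(D_3 *\<^sub>v y) $ 4 = y $ 5 - y $ 4"
    and "(D_3 *\<^sub>v y) $ 5 = y $ 1 + y $ 3 + y $ 5 - y $ 6 - y $ 4"
    and "(D_3 *\<^sub>v y) $ 6 = 2 * (y $ 1 + y $ 3 + y $ 5 - y $ 6) - y $ 0 - y $ 2 - y $ 4"
    using assms by (simp_all add: D_3_def mat_of_rows_list_def scalar_prod_def)
qed

lemma all_less_6: "(\<forall>i<6. P i) \<longleftrightarrow> P 0 \<and> P 1 \<and> P 2 \<and> P 3 \<and> P 4 \<and> P (5::nat)"
  by (auto simp: numeral_eq_Suc All_less_Suc)

text \<open>The triangle inequality comes from the bound of the weights at level \<open>3\<close>, where the leading
  projections of the three branches vanish. In the other direction the system of level \<open>4\<close> is obtained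
  from a one-dimensional one by an even and an odd reflection.\<close>

lemma realizable_4_iff:
  assumes y: "dim_vec y = 7"
  shows "realizable 4 y \<longleftrightarrow> (\<forall>i<6. (D_3 *\<^sub>v y) $ i > 0) \<and> (D_3 *\<^sub>v y) $ 6 = 0"
    (is "_ \<longleftrightarrow> ?R")
proof
  assume r: "realizable 4 y"
  have pos: "0 < edge_weight y g" for g using r by (simp add: realizable_def positive_weight_def)
  have "realizable 3 (c_bullet y)" using realizable_c_bullet[of 4 y] r by simp
  then obtain p where p: "e6_system (level_dim 3) (edge_weight (c_bullet y)) (c_bullet y $ 6)
      (level_rank 3) p" and pos': "\<And>g. 0 < edge_weight (c_bullet y) g"
    by (auto simp: realizable_def positive_weight_def)
  have b: "edge_weight (c_bullet y) g < c_bullet y $ 6" if "\<not> is_leading g" for g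
    by (rule e6_system_weight_bound[OF p _ pos']) (use that in \<open>simp_all add: level_dim_def level_rank_def\<close>)
  have "y $ 0 < y $ 1 + y $ 3 + y $ 5 - y $ 6" "y $ 2 < y $ 1 + y $ 3 + y $ 5 - y $ 6"
    "y $ 4 < y $ 1 + y $ 3 + y $ 5 - y $ 6"
    using b[of P2] b[of Q2] b[of S2] by (simp_all add: c_bullet_index)
  moreover have "y $ 0 < y $ 1" "y $ 2 < y $ 3" "y $ 4 < y $ 5"
    using pos[of P2] pos[of Q2] pos[of S2] by simp_all
  moreover have "y $ 0 + y $ 2 + y $ 4 = 2 * (y $ 1 + y $ 3 + y $ 5 - y $ 6)"
    using e6_system_trace[OF p]
    by (simp add: sum_e6_gen level_rank_def level_dim_def c_bullet_index)
  ultimately show ?R by (simp add: all_less_6 D_3_mult_vec[OF y] del: One_nat_def)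
next
  assume ?R
  then have pos: "y $ 0 < y $ 1" "y $ 2 < y $ 3" "y $ 4 < y $ 5"
    and lt: "y $ 0 < y $ 1 + y $ 3 + y $ 5 - y $ 6" "y $ 2 < y $ 1 + y $ 3 + y $ 5 - y $ 6"
      "y $ 4 < y $ 1 + y $ 3 + y $ 5 - y $ 6"
    and tr: "y $ 0 + y $ 2 + y $ 4 = 2 * (y $ 1 + y $ 3 + y $ 5 - y $ 6)"
    by (simp_all add: all_less_6 D_3_mult_vec[OF y] del: One_nat_def)
  have "0 < y $ 0" using lt(2,3) tr by argo
  moreover have "0 < y $ 2" using lt(1,3) tr by argo
  moreover have "0 < y $ 4" using lt(1,2) tr by argo
  ultimately have y0: "0 < y $ 0" "0 < y $ 2" "0 < y $ 4" by blast+
  define \<gamma> where "\<gamma> = c_bullet y $ 6"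
  have g: "0 < \<gamma>" "edge_weight (c_bullet y) P2 < \<gamma>" "edge_weight (c_bullet y) Q2 < \<gamma>"
    "edge_weight (c_bullet y) S2 < \<gamma>"
    using lt y0 by (simp_all add: \<gamma>_def c_bullet_index)
  \<comment> \<open>On the leading generators \<open>a\<close> is the even reflection of the weights at level 3. The other
    projections vanish in dimension one, so any value between 0 and \<open>\<gamma>\<close> serves for them.\<close>
  define a where "a g = (if is_leading g
    then \<gamma> - edge_weight (c_bullet y) (branch_partner g) else \<gamma> / 2)" for g
  have a: "0 < a g" "a g < \<gamma>" for g
    using g pos y0 by (cases g; simp add: a_def c_bullet_index)+
  have "a P1 + a Q1 + a S1 = \<gamma>"
    using tr by (simp add: a_def \<gamma>_def c_bullet_index)
  note one = e6_system_one_dimensional[of a, OF this]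
  let ?r = "\<lambda>g. if is_leading g then 1 else 0 :: nat"
  have r: "(\<Sum>g\<in>UNIV. ?r g) = 3" by (simp add: sum_e6_gen)
  have big: "1 < (\<Sum>g\<in>UNIV. ?r g)" unfolding r by simp
  obtain p where "e6_system ((\<Sum>g\<in>UNIV. ?r g) - 1) (\<lambda>g. \<gamma> - a (branch_partner g)) \<gamma>
      (\<lambda>g. ?r (branch_partner g)) p"
    by (rule e6_system_reflect_even[OF one a big]) (rule that)
  moreover have "level_rank 3 = (\<lambda>g. ?r (branch_partner g))"
    by (auto simp: level_rank_def)
  ultimately have "e6_system 2 (\<lambda>g. \<gamma> - a (branch_partner g)) \<gamma> (level_rank 3) p"
    by (simp only: r) simp
  then have "e6_system 2 (edge_weight (c_bullet y)) \<gamma> (level_rank 3) p"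
    by (rule e6_system_change_vacuous_weight) (simp add: level_rank_def a_def split: if_splits)
  moreover have "positive_weight (c_bullet y)"
    unfolding positive_weight_def
  proof (intro conjI allI impI)
    show "0 < edge_weight (c_bullet y) g" for g
      using y0 pos by (cases g) (simp_all add: c_bullet_index)
    show "edge_weight (c_bullet y) (branch_partner g) < edge_weight (c_bullet y) g" if "is_leading g" for g
      using y0 pos that by (cases g) (simp_all add: c_bullet_index)
  qed
  moreover have "level_dim 3 = 2" by (simp add: level_dim_def)
  ultimately have "realizable 3 (c_bullet y)"
    unfolding realizable_def \<gamma>_def by (simp only:) blast
  then have "realizable 4 (c_bullet (c_bullet y))" using realizable_c_bullet[of 3 "c_bullet y"] by simp
  then show "realizable 4 y" by (simp add: realizable_c_bullet_c_bullet)
qed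

lemma realizable_iff_D_map:
  assumes "4 \<le> k"
  shows "realizable k (M_f \<chi>) \<longleftrightarrow> (\<forall>i<6. D_map k \<chi> $ i > 0) \<and> D_map k \<chi> $ 6 = 0"
proof -
  define E where "E k = (if even k then coxeter ^^ (k div 2 - 2)
    else (coxeter ^^ (k div 2 - 2)) \<circ> c_circ)" for k
  have D: "D_map k \<chi> = D_3 *\<^sub>v E k (M_f \<chi>)" by (simp add: D_map_def E_def)
  have E_Suc: "E (Suc k) y = E k (if even (Suc k) then c_bullet y else c_circ y)" if k: "4 \<le> k" for k y
  proof (cases "even k")
    case True
    then show ?thesis by (simp add: E_def)
  next
    case False
    then obtain s where s: "k = 2 * s + 1" by (rule oddE)
    then have "Suc k div 2 - 2 = Suc (k div 2 - 2)" using k by simp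
    then show ?thesis using False unfolding E_def by (simp add: funpow_swap1 coxeter_def)
  qed
  have "(realizable k y \<longleftrightarrow> realizable 4 (E k y)) \<and> dim_vec (E k y) = 7"
    if "dim_vec y = 7" for y
    using assms that
  proof (induction k arbitrary: y rule: dec_induct)
    case base
    then show ?case by (simp add: E_def)
  next
    case (step k)
    show ?case
      unfolding realizable_step[OF step.hyps(1)] E_Suc[OF step.hyps(1)]
      by (rule step.IH) (simp add: dim_reflections)
  qed
  from this[of "M_f \<chi>"] show ?thesis
    using realizable_4_iff[of "E k (M_f \<chi>)"] by (simp add: D dim_reflections)
qed

section \<open>Representations as projection systems\<close>

lemma matrix_star_alg_simps:
  "carrier (matrix_star_alg n) = carrier_mat n n"
  "monoid.mult (matrix_star_alg n) = (*)" "monoid.one (matrix_star_alg n) = 1\<^sub>m n"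
  "ring.zero (matrix_star_alg n) = 0\<^sub>m n n" "ring.add (matrix_star_alg n) = (+)"
  "module.smult (matrix_star_alg n) = (\<cdot>\<^sub>m)" "star (matrix_star_alg n) = mat_adjoint"
  by (simp_all add: matrix_star_alg_def)

lemma star_rep_eval:
  assumes "star_rep \<chi> n \<pi>"
  shows "\<pi> (star_class (e6_relations \<chi>) x) =
      star_eval (matrix_star_alg n) (\<lambda>g. \<pi> (e6_gen_elem \<chi> g)) x"
    and "\<pi> (star_class (e6_relations \<chi>) x) \<in> carrier_mat n n"
proof -
  let ?R = "e6_relations \<chi>"
  have h: "\<pi> \<in> star_hom (presented_star_alg ?R) (matrix_star_alg n)"
    using assms by (simp add: star_rep_def e6_alg_def)
  have cl: "\<pi> (star_class ?R x) \<in> carrier_mat n n" for x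
    using h star_class_in_carrier[of ?R x]
    by (auto simp: star_hom_def Ring.ring_hom_def matrix_star_alg_simps)
  then show "\<pi> (star_class ?R x) \<in> carrier_mat n n" .
  have ops: "\<pi> (star_class ?R (Mult x y)) = \<pi> (star_class ?R x) * \<pi> (star_class ?R y)"
    "\<pi> (star_class ?R (Add x y)) = \<pi> (star_class ?R x) + \<pi> (star_class ?R y)"
    "\<pi> (star_class ?R One) = 1\<^sub>m n"
    "\<pi> (star_class ?R (Scale c x)) = c \<cdot>\<^sub>m \<pi> (star_class ?R x)"
    "\<pi> (star_class ?R (Star x)) = mat_adjoint (\<pi> (star_class ?R x))" for x y c
    using h star_class_in_carrier[of ?R x] star_class_in_carrier[of ?R y]
    unfolding star_hom_def Ring.ring_hom_def mem_Collect_eq matrix_star_alg_simps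
    by (metis presented_ops)+
  have "star_class ?R Zero = star_class ?R (Add (Scale (- 1) One) One)"
    by (simp add: star_class_eq_iff star_cong.sym star_cong.add_inverse)
  then have zero: "\<pi> (star_class ?R Zero) = 0\<^sub>m n n"
    by (simp add: ops) (intro eq_matI, auto)
  show "\<pi> (star_class ?R x) = star_eval (matrix_star_alg n) (\<lambda>g. \<pi> (e6_gen_elem \<chi> g)) x"
    by (induction x) (simp_all add: ops zero matrix_star_alg_simps e6_gen_elem_def)
qed

lemma edge_weight_M_f:
  "edge_weight (M_f \<chi>) P1 = \<chi> $ 0" "edge_weight (M_f \<chi>) P2 = \<chi> $ 1"
  "edge_weight (M_f \<chi>) Q1 = \<chi> $ 2" "edge_weight (M_f \<chi>) Q2 = \<chi> $ 3"
  "edge_weight (M_f \<chi>) S1 = \<chi> $ 4" "edge_weight (M_f \<chi>) S2 = \<chi> $ 5"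
  "M_f \<chi> $ 6 = \<chi> $ 6"
  by (simp_all add: M_f_def vec_of_list_index del: vec_of_list_Cons)

lemma e6_relations_iff:
  assumes p: "\<And>g. p g \<in> carrier_mat n n"
  shows "(\<forall>(x, y)\<in>e6_relations \<chi>. star_eval (matrix_star_alg n) p x = star_eval (matrix_star_alg n) p y)
    \<longleftrightarrow> projection_family n p \<and>
      sums_to n (of_real (M_f \<chi> $ 6)) (\<lambda>g. of_real (edge_weight (M_f \<chi>) g) \<cdot>\<^sub>m p g) \<and>
      (\<forall>g. p g * p (branch_partner g) = 0\<^sub>m n n)"
proof -
  have d [simp]: "dim_row (p g) = n" "dim_col (p g) = n" for g using p[of g] by auto
  have all: "(\<forall>g. P g) \<longleftrightarrow> P P1 \<and> P P2 \<and> P Q1 \<and> P Q2 \<and> P S1 \<and> P S2" for P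
    by (metis e6_gen.exhaust)
  let ?c = "\<lambda>i. complex_of_real (\<chi> $ i)"
  have "sums_to n (of_real (M_f \<chi> $ 6)) (\<lambda>g. of_real (edge_weight (M_f \<chi>) g) \<cdot>\<^sub>m p g) \<longleftrightarrow>
    ?c 0 \<cdot>\<^sub>m p P1 + (?c 1 \<cdot>\<^sub>m p P2 + (?c 2 \<cdot>\<^sub>m p Q1 + (?c 3 \<cdot>\<^sub>m p Q2 +
      (?c 4 \<cdot>\<^sub>m p S1 + ?c 5 \<cdot>\<^sub>m p S2)))) = ?c 6 \<cdot>\<^sub>m 1\<^sub>m n"
    unfolding sums_to_def sum_e6_gen edge_weight_M_f mat_eq_iff
    using p by (auto simp: add.assoc)
  then show ?thesis
    unfolding e6_relations_def projection_family_def
    by (auto simp: matrix_star_alg_simps p all)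
qed

lemma subspace_iff_vec_subspace:
  "VectorSpace.subspace class_ring W (module_vec TYPE(complex) n) \<longleftrightarrow> vec_subspace n W"
proof -
  interpret vec_space "TYPE(complex)" n .
  show ?thesis
    unfolding VectorSpace.subspace_def submodule_def vec_subspace_def
    by (auto simp: vec_vs vec_module module_vec_simps)
qed

text \<open>Invariance under the six generators passes to every expression in them. Since the induction also
  meets \<open>Star\<close>, it has to treat the adjoint of each value along with the value; at the generators the
  two agree.\<close>

lemma irreducible_rep_iff:
  assumes rep: "star_rep \<chi> n \<pi>"
    and fam: "projection_family n (\<lambda>g. \<pi> (e6_gen_elem \<chi> g))"
  shows "irreducible_rep \<chi> n \<pi> \<longleftrightarrow> irreducible_family n (\<lambda>g. \<pi> (e6_gen_elem \<chi> g))"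
proof -
  let ?p = "\<lambda>g. \<pi> (e6_gen_elem \<chi> g)" and ?R = "e6_relations \<chi>"
  let ?ev = "star_eval (matrix_star_alg n) ?p"
  have ev: "\<pi> (star_class ?R x) = ?ev x" for x by (rule star_rep_eval(1)[OF rep])
  have c: "?ev x \<in> carrier_mat n n" for x
    using star_rep_eval(2)[OF rep, of x] by (simp only: ev)
  have inv: "(\<forall>a\<in>carrier (e6_alg \<chi>). \<forall>w\<in>W. \<pi> a *\<^sub>v w \<in> W) \<longleftrightarrow> (\<forall>g. \<forall>w\<in>W. ?p g *\<^sub>v w \<in> W)"
    if W: "vec_subspace n W" for W
  proof
    assume "\<forall>a\<in>carrier (e6_alg \<chi>). \<forall>w\<in>W. \<pi> a *\<^sub>v w \<in> W"
    then show "\<forall>g. \<forall>w\<in>W. ?p g *\<^sub>v w \<in> W"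
      using star_class_in_carrier unfolding e6_gen_elem_def e6_alg_def by blast
  next
    assume g: "\<forall>g. \<forall>w\<in>W. ?p g *\<^sub>v w \<in> W"
    have wc: "w \<in> carrier_vec n" if "w \<in> W" for w using W that by (auto simp: vec_subspace_def)
    have Wadd: "x + y \<in> W" if "x \<in> W" "y \<in> W" for x y using W that by (auto simp: vec_subspace_def)
    have Wsc: "s \<cdot>\<^sub>v x \<in> W" if "x \<in> W" for s x using W that by (auto simp: vec_subspace_def)
    have W0: "0\<^sub>v n \<in> W" using W by (simp add: vec_subspace_def)
    have ca: "mat_adjoint (?ev x) \<in> carrier_mat n n" for x by (rule mat_adjoint_carrier[OF c])
    have smv: "(s \<cdot>\<^sub>m A) *\<^sub>v w = s \<cdot>\<^sub>v (A *\<^sub>v w)"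
      if "A \<in> carrier_mat n n" "w \<in> carrier_vec n" for s A and w :: "complex vec"
      using that by (intro eq_vecI) (auto simp: row_smult)
    have "(\<forall>w\<in>W. ?ev x *\<^sub>v w \<in> W) \<and> (\<forall>w\<in>W. mat_adjoint (?ev x) *\<^sub>v w \<in> W)" for x
    proof (induction x)
      case (Gen h)
      then show ?case using g fam by (simp add: projection_family_def)
    next
      case Zero
      have "0\<^sub>m n n *\<^sub>v w = 0\<^sub>v n" if "w \<in> W" for w
        using wc[OF that] by (intro eq_vecI) auto
      moreover have "mat_adjoint (0\<^sub>m n n) = (0\<^sub>m n n :: complex mat)" by (intro eq_matI) auto
      ultimately show ?case using W0 by (simp add: matrix_star_alg_simps)
    next
      case One
      have "mat_adjoint (1\<^sub>m n) = (1\<^sub>m n :: complex mat)" by (intro eq_matI) auto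
      then show ?case using wc by (simp add: matrix_star_alg_simps)
    next
      case (Add x y)
      have "mat_adjoint (?ev x + ?ev y) = mat_adjoint (?ev x) + mat_adjoint (?ev y)"
        using c[of x] c[of y] by (intro eq_matI) auto
      then show ?case
        using Add wc Wadd
        by (simp add: matrix_star_alg_simps add_mult_distrib_mat_vec[OF c c] add_mult_distrib_mat_vec[OF ca ca])
    next
      case (Mult x y)
      then show ?case
        using wc by (simp add: matrix_star_alg_simps mat_adjoint_mult[OF c c]
          assoc_mult_mat_vec[OF c c] assoc_mult_mat_vec[OF ca ca])
    next
      case (Scale s x)
      then show ?case
        using wc Wsc by (simp add: matrix_star_alg_simps mat_adjoint_smult smv[OF c] smv[OF ca])
    next
      case (Star x)
      then show ?case by (simp add: matrix_star_alg_simps)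
    qed
    then show "\<forall>a\<in>carrier (e6_alg \<chi>). \<forall>w\<in>W. \<pi> a *\<^sub>v w \<in> W"
      unfolding e6_alg_def by (metis ev presented_carrierE)
  qed
  show ?thesis
    unfolding irreducible_rep_def irreducible_family_def subspace_iff_vec_subspace
    using inv by blast
qed

lemma d_vec_index:
  "i < 7 \<Longrightarrow>
    d_vec k $ i = v_vec ((k - 1) mod 4 + 1) $ i + int ((k - 1) div 4) * delta_vec $ i"
  by (simp add: d_vec_def delta_vec_def)

lemma mod_4_simps:
  "Suc (4 * q) mod 4 = 1" "Suc (Suc (4 * q)) mod 4 = 2" "Suc (Suc (Suc (4 * q))) mod 4 = 3"
  by presburger+

lemma M_d_d_vec:
  assumes "1 \<le> k"
  shows "M_d (d_vec k) = vec_of_list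
    (map (\<lambda>g. int (level_rank k g)) [P1, P2, Q1, Q2, S1, S2] @ [int (level_dim k)])"
  using assms
  by (cases rule: positive_nat_mod_4_cases[OF assms]; simp add: M_d_def d_vec_index v_vec_def delta_vec_def vec_of_list_index level_rank_def
      level_dim_def div_4_simps mod_4_simps del: vec_of_list_Cons)
    (simp_all add: ac_simps del: vec_of_list_Cons)

lemma generalized_dim_iff:
  assumes "1 \<le> k"
  shows "generalized_dim \<chi> n \<pi> = M_d (d_vec k) \<longleftrightarrow>
    n = level_dim k \<and> (\<forall>g. vec_space.rank n (\<pi> (e6_gen_elem \<chi> g)) = level_rank k g)"
proof -
  have all: "(\<forall>g. P g) \<longleftrightarrow> P P1 \<and> P P2 \<and> P Q1 \<and> P Q2 \<and> P S1 \<and> P S2" for P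
    by (metis e6_gen.exhaust)
  have inj: "vec_of_list xs = vec_of_list ys \<longleftrightarrow> xs = ys" for xs ys :: "int list"
    by (metis list_vec)
  show ?thesis
    unfolding M_d_d_vec[OF assms] generalized_dim_def inj all by auto
qed

text \<open>From level \<open>5\<close> on, all ranks and all coranks \<open>n - r\<^sub>1 - r\<^sub>2\<close> are positive, so non-degeneracy holds
  whenever the generalized dimension is the prescribed one.\<close>

lemma level_nondegenerate:
  assumes sys: "e6_system (level_dim k) a \<gamma> (level_rank k) p" and k: "5 \<le> k"
  shows "p g \<noteq> 0\<^sub>m (level_dim k) (level_dim k)"
    and "p g + p (branch_partner g) \<noteq> 1\<^sub>m (level_dim k)"
proof -
  have tr: "mat_trace (p g) = of_nat (level_rank k g)"
    and d: "dim_row (p g) = level_dim k" "dim_col (p g) = level_dim k" for g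
    using sys by (auto simp: e6_system_def projection_family_def)
  have "0 < level_rank k g \<and> level_rank k g + level_rank k (branch_partner g) < level_dim k"
  proof -
    have "1 \<le> k" using k by simp
    then show ?thesis
      using k by (cases rule: positive_nat_mod_4_cases) (auto simp: level_rank_def level_dim_def div_4_simps)
  qed
  then have pos: "0 < level_rank k g" and less: "level_rank k g + level_rank k (branch_partner g) < level_dim k"
    by auto
  show "p g \<noteq> 0\<^sub>m (level_dim k) (level_dim k)"
    using tr[of g] pos by (auto simp: mat_trace_def)
  have "mat_trace (p g + p (branch_partner g)) =
      of_nat (level_rank k g + level_rank k (branch_partner g))"
    using tr[of g] tr[of "branch_partner g"] d by (simp add: mat_trace_def sum.distrib)
  moreover have "mat_trace (1\<^sub>m (level_dim k)) = of_nat (level_dim k)" by (simp add: mat_trace_def)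
  ultimately show "p g + p (branch_partner g) \<noteq> 1\<^sub>m (level_dim k)"
    using less by (metis less_irrefl of_nat_eq_iff)
qed

lemma exists_rep_iff_system:
  assumes k: "5 \<le> k"
  shows "(\<exists>n \<pi>. star_rep \<chi> n \<pi> \<and> irreducible_rep \<chi> n \<pi> \<and> nondegenerate_rep \<chi> n \<pi> \<and>
      generalized_dim \<chi> n \<pi> = M_d (d_vec k)) \<longleftrightarrow>
    (\<exists>p. e6_system (level_dim k) (edge_weight (M_f \<chi>)) (M_f \<chi> $ 6) (level_rank k) p)"
    (is "?L \<longleftrightarrow> ?R")
proof
  have k1: "1 \<le> k" using k by simp
  {
    assume ?L
    then obtain n \<pi> where rep: "star_rep \<chi> n \<pi>" and irr: "irreducible_rep \<chi> n \<pi>"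
      and dim: "generalized_dim \<chi> n \<pi> = M_d (d_vec k)" by blast
    let ?p = "\<lambda>g. \<pi> (e6_gen_elem \<chi> g)"
    have pc: "?p g \<in> carrier_mat n n" for g
      unfolding e6_gen_elem_def by (rule star_rep_eval(2)[OF rep])
    have "star_eval (matrix_star_alg n) ?p x = star_eval (matrix_star_alg n) ?p y"
      if "(x, y) \<in> e6_relations \<chi>" for x y
      using star_cong.rel[OF that]
      by (simp only: star_rep_eval(1)[OF rep, symmetric] flip: star_class_eq_iff)
    then have *: "projection_family n ?p \<and>
      sums_to n (of_real (M_f \<chi> $ 6)) (\<lambda>g. of_real (edge_weight (M_f \<chi>) g) \<cdot>\<^sub>m ?p g) \<and>
      (\<forall>g. ?p g * ?p (branch_partner g) = 0\<^sub>m n n)"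
      using e6_relations_iff[of ?p n \<chi>, OF pc] by blast
    have n: "n = level_dim k" and r: "vec_space.rank n (?p g) = level_rank k g" for g
      using dim unfolding generalized_dim_iff[OF k1] by auto
    have "mat_trace (?p g) = of_nat (level_rank k g)" for g
      using trace_projection[of "?p g" n] * by (simp add: projection_family_def r)
    moreover have "irreducible_family n ?p"
      using irreducible_rep_iff[OF rep] * irr by blast
    ultimately have "e6_system n (edge_weight (M_f \<chi>)) (M_f \<chi> $ 6) (level_rank k) ?p"
      using * by (simp add: e6_system_def)
    then show ?R using n by blast
  }
  assume ?R
  define n where "n = level_dim k"
  obtain p where sys: "e6_system n (edge_weight (M_f \<chi>)) (M_f \<chi> $ 6) (level_rank k) p"
    using \<open>?R\<close> by (auto simp: n_def)
  have pc: "p g \<in> carrier_mat n n" and pa: "mat_adjoint (p g) = p g" and pp: "p g * p g = p g"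
    and tr: "mat_trace (p g) = of_nat (level_rank k g)" for g
    using sys by (auto simp: e6_system_def projection_family_def)
  have "\<forall>(x, y)\<in>e6_relations \<chi>. star_eval (matrix_star_alg n) p x = star_eval (matrix_star_alg n) p y"
    unfolding e6_relations_iff[OF pc] using sys by (simp add: e6_system_def)
  then obtain \<pi> where rep: "star_rep \<chi> n \<pi>"
    and \<pi>: "\<And>x. \<pi> (star_class (e6_relations \<chi>) x) = star_eval (matrix_star_alg n) p x"
    using presented_universal[OF star_algebra_matrix, of p n "e6_relations \<chi>"] pc
    unfolding star_rep_def e6_alg_def by (auto simp: matrix_star_alg_simps)
  have p: "(\<lambda>g. \<pi> (e6_gen_elem \<chi> g)) = p" by (simp add: e6_gen_elem_def \<pi>)
  have p': "\<pi> (e6_gen_elem \<chi> g) = p g" for g using fun_cong[OF p] .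
  have "irreducible_rep \<chi> n \<pi>"
    using irreducible_rep_iff[OF rep] sys unfolding p by (simp add: e6_system_def)
  moreover have "nondegenerate_rep \<chi> n \<pi>"
    using level_nondegenerate[OF sys[unfolded n_def] k]
    unfolding nondegenerate_rep_def p' n_def by (metis branch_partner.simps)
  moreover have "vec_space.rank n (p g) = level_rank k g" for g
    using trace_projection[OF pc pa pp, of g] by (simp add: tr)
  then have "generalized_dim \<chi> n \<pi> = M_d (d_vec k)"
    unfolding generalized_dim_iff[OF k1] p' by (simp add: n_def)
  ultimately show ?L using rep by blast
qed

theorem theorem5:
  fixes \<alpha>1 \<alpha>2 \<beta>1 \<beta>2 \<delta>1 \<delta>2 \<gamma> :: real and \<chi> :: "real vec" and k :: nat
  assumes "\<chi> = vec_of_list [\<alpha>1, \<alpha>2, \<beta>1, \<beta>2, \<delta>1, \<delta>2, \<gamma>]"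
    and "\<alpha>1 > \<alpha>2" "\<alpha>2 > 0"
    and "\<beta>1 > \<beta>2" "\<beta>2 > 0"
    and "\<delta>1 > \<delta>2" "\<delta>2 > 0"
    and "k \<ge> 5"
  shows "(\<exists>n \<pi>. star_rep \<chi> n \<pi> \<and> irreducible_rep \<chi> n \<pi> \<and> nondegenerate_rep \<chi> n \<pi> \<and>
            generalized_dim \<chi> n \<pi> = M_d (d_vec k)) \<longleftrightarrow>
         (\<forall>i < 6. D_map k \<chi> $ i > 0) \<and> D_map k \<chi> $ 6 = 0"
proof -
  have \<chi>: "\<chi> $ 0 = \<alpha>1" "\<chi> $ 1 = \<alpha>2" "\<chi> $ 2 = \<beta>1" "\<chi> $ 3 = \<beta>2" "\<chi> $ 4 = \<delta>1" "\<chi> $ 5 = \<delta>2"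
    by (simp_all add: assms(1) vec_of_list_index del: vec_of_list_Cons)
  have "positive_weight (M_f \<chi>)"
    unfolding positive_weight_def
  proof (intro conjI allI impI)
    show "0 < edge_weight (M_f \<chi>) g" for g
      using assms(2-7) by (cases g) (simp_all add: edge_weight_M_f \<chi> del: edge_weight.simps One_nat_def)
    show "edge_weight (M_f \<chi>) (branch_partner g) < edge_weight (M_f \<chi>) g" if "is_leading g" for g
      using assms(2-7) that
      by (cases g) (simp_all add: edge_weight_M_f \<chi> del: edge_weight.simps One_nat_def)
  qed
  then show ?thesis
    unfolding exists_rep_iff_system[OF assms(8)] using realizable_iff_D_map[of k \<chi>] assms(8)
    by (simp add: realizable_def)
qed

end
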